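(* Under hypotheses (A) and (B), the essential spectral radius $r_e^*$ of the Jackson network process satisfies $$-\min_{1\le i\le d}\frac{1}{G_{ii}}\bigl(\sqrt{\mu_i}-\sqrt{\nu_i}\bigr)^2\le\log r_e^*.$$
   Context: Jackson network with $d$ queues: arrival rates $\lambda_i\ge0$, service rates $\mu_i>0$, routing matrix $P=(p_{ij})_{i,j=1}^d$ nonnegative with $p_{ii}=0$, $\sum_jp_{ij}\le1$, $p_{i0}=1-\sum_jp_{ij}$. The queue-length process $(Z(t))$ is the continuous-time Markov process on $\mathbb{Z}_+^d$ with jumps $+\epsilon^i$ at rate $\lambda_i$, $-\epsilon^i$ at rate $\mu_ip_{i0}$, $\epsilon^j-\epsilon^i$ at rate $\mu_ip_{ij}$ (jumps that would leave $\mathbb{Z}_+^d$ are suppressed). Hypothesis (A): the kernel $(q(x-y))_{x,y\in\mathbb{Z}^d}$ of these jump rates is irreducible (equivalently: spectral radius of $P$ $<1$, and for every $i$ there are $n,j$ with $\lambda_jp^{(n)}_{ji}>0$). Traffic equations $\nu_j=\lambda_j+\sum_i\nu_ip_{ij}$ then have a unique solution with $\nu_i>0$. Hypothesis (B): $\nu_i<\mu_i$ for all $i$. $G=(I-P)^{-1}$. For finite $E\subset\mathbb{Z}_+^d$ let $\tau_E=\inf\{t>0:Z(t)\in E\}$. The essential spectral radius $r_e^*$ is the infimum of all $r>0$ for which there is a finite $E\subset\mathbb{Z}_+^d$ with $\int_0^\infty r^{-t}\mathbb{P}_x(Z(t)=y,\tau_E>t)\,dt<\infty$ for all $x,y\in\mathbb{Z}_+^d\setminus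 E$. *)

theory Defs
  imports "HOL-Analysis.Analysis"
begin

text \<open>Jackson network with queues indexed by a finite type 'd (d = CARD('d)).
  Arrival rates lam, service rates mu, routing matrix P (entries P$i$j).
  States of the queue-length process are functions 'd \<Rightarrow> nat (= Z_+^d).\<close>

definition p0 :: "real^'d^'d \<Rightarrow> 'd::finite \<Rightarrow> real" where
  "p0 P i = 1 - (\<Sum>j\<in>UNIV. P$i$j)"

definition unitv :: "'d \<Rightarrow> 'd \<Rightarrow> int" where
  "unitv i = (\<lambda>k. if k = i then 1 else 0)"

text \<open>Jump kernel q(z), z in Z^d, of the free (unreflected) random walk.\<close>
definition jump_kernel ::
  "('d::finite \<Rightarrow> real) \<Rightarrow> ('d \<Rightarrow> real) \<Rightarrow> real^'d^'d \<Rightarrow> ('d \<Rightarrow> int) \<Rightarrow> real" where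
  "jump_kernel lam mu P z =
     (\<Sum>i\<in>UNIV. (if z = unitv i then lam i else 0)
              + (if z = (\<lambda>k. - unitv i k) then mu i * p0 P i else 0)
              + (\<Sum>j\<in>UNIV. if j \<noteq> i \<and> z = (\<lambda>k. unitv j k - unitv i k)
                             then mu i * P$i$j else 0))"

text \<open>Hypothesis (A): the kernel (q(y - x))_{x,y in Z^d} is irreducible.\<close>
definition jackson_irreducible ::
  "('d::finite \<Rightarrow> real) \<Rightarrow> ('d \<Rightarrow> real) \<Rightarrow> real^'d^'d \<Rightarrow> bool" where
  "jackson_irreducible lam mu P \<longleftrightarrow>
     (\<forall>x y :: 'd \<Rightarrow> int.
        (x, y) \<in> {(u, v). jump_kernel lam mu P (\<lambda>k. v k - u k) > 0}\<^sup>*)"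

text \<open>Jump rate from x to y (x \<noteq> y) of the queue-length process on Z_+^d
  (jumps leaving Z_+^d are suppressed).\<close>
definition jrate ::
  "('d::finite \<Rightarrow> real) \<Rightarrow> ('d \<Rightarrow> real) \<Rightarrow> real^'d^'d \<Rightarrow> ('d \<Rightarrow> nat) \<Rightarrow> ('d \<Rightarrow> nat) \<Rightarrow> real" where
  "jrate lam mu P x y =
     (\<Sum>i\<in>UNIV. (if y = x(i := x i + 1) then lam i else 0)
              + (if 0 < x i \<and> y = x(i := x i - 1) then mu i * p0 P i else 0)
              + (\<Sum>j\<in>UNIV. if j \<noteq> i \<and> 0 < x i \<and> y = (x(i := x i - 1))(j := x j + 1)
                             then mu i * P$i$j else 0))"

text \<open>Total rate of (non-suppressed) jumps out of x.\<close>
definition outrate ::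
  "('d::finite \<Rightarrow> real) \<Rightarrow> ('d \<Rightarrow> real) \<Rightarrow> real^'d^'d \<Rightarrow> ('d \<Rightarrow> nat) \<Rightarrow> real" where
  "outrate lam mu P x =
     (\<Sum>i\<in>UNIV. lam i + (if 0 < x i then mu i * (p0 P i + (\<Sum>j\<in>UNIV - {i}. P$i$j)) else 0))"

text \<open>Uniformization constant (strictly larger than every total jump rate).\<close>
definition unif_const :: "('d::finite \<Rightarrow> real) \<Rightarrow> ('d \<Rightarrow> real) \<Rightarrow> real" where
  "unif_const lam mu = 1 + (\<Sum>i\<in>UNIV. lam i) + (\<Sum>i\<in>UNIV. mu i)"

text \<open>One-step kernel of the uniformized chain.\<close>
definition unif_kernel ::
  "('d::finite \<Rightarrow> real) \<Rightarrow> ('d \<Rightarrow> real) \<Rightarrow> real^'d^'d \<Rightarrow> ('d \<Rightarrow> nat) \<Rightarrow> ('d \<Rightarrow> nat) \<Rightarrow> real" where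
  "unif_kernel lam mu P x y =
     jrate lam mu P x y / unif_const lam mu
     + (if y = x then 1 - outrate lam mu P x / unif_const lam mu else 0)"

text \<open>n-step kernel of the uniformized chain, restricted to paths whose
  states after step 0 all avoid E.\<close>
primrec taboo_steps ::
  "('d::finite \<Rightarrow> real) \<Rightarrow> ('d \<Rightarrow> real) \<Rightarrow> real^'d^'d \<Rightarrow> ('d \<Rightarrow> nat) set \<Rightarrow> nat
     \<Rightarrow> ('d \<Rightarrow> nat) \<Rightarrow> ('d \<Rightarrow> nat) \<Rightarrow> ennreal" where
  "taboo_steps lam mu P E 0 x y = (if x = y then 1 else 0)"
| "taboo_steps lam mu P E (Suc n) x y =
     (\<integral>\<^sup>+ z. ennreal (unif_kernel lam mu P x z) * indicator (- E) z
              * taboo_steps lam mu P E n z y \<partial>count_space UNIV)"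

text \<open>Taboo transition function P_x(Z(t) = y, tau_E > t), computed by uniformization.\<close>
definition taboo_prob ::
  "('d::finite \<Rightarrow> real) \<Rightarrow> ('d \<Rightarrow> real) \<Rightarrow> real^'d^'d \<Rightarrow> ('d \<Rightarrow> nat) set \<Rightarrow> real
     \<Rightarrow> ('d \<Rightarrow> nat) \<Rightarrow> ('d \<Rightarrow> nat) \<Rightarrow> ennreal" where
  "taboo_prob lam mu P E t x y =
     (\<Sum>n. ennreal (exp (- unif_const lam mu * t) * (unif_const lam mu * t) ^ n / fact n)
           * taboo_steps lam mu P E n x y)"

text \<open>Essential spectral radius r_e^*.\<close>
definition ess_spec_radius ::
  "('d::finite \<Rightarrow> real) \<Rightarrow> ('d \<Rightarrow> real) \<Rightarrow> real^'d^'d \<Rightarrow> real" where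
  "ess_spec_radius lam mu P =
     Inf {r::real. 0 < r \<and>
       (\<exists>E. finite E \<and>
          (\<forall>x y. x \<notin> E \<longrightarrow> y \<notin> E \<longrightarrow>
             (\<integral>\<^sup>+ t. indicator {0..} t * ennreal (r powr (- t)) * taboo_prob lam mu P E t x y
                \<partial>lborel) < \<infinity>))}"

end

theory Submission
  imports Defs
begin

text \<open>
  Let \<open>i\<close> attain the minimum and put \<open>s\<^sub>i = (\<surd>\<mu>\<^sub>i - \<surd>\<nu>\<^sub>i)\<^sup>2 / G\<^sub>i\<^sub>i\<close>. If for every \<open>s > s\<^sub>i\<close> and
  every finite \<open>E\<close> there is a nonzero, finitely supported \<open>f \<ge> 0\<close> vanishing on \<open>E\<close> with
  \<open>L f \<ge> - s f\<close> for the generator \<open>L\<close>, then the taboo semigroup decays no faster than \<open>exp (- s t)\<close> on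
  \<open>f\<close>, so the integrals defining the essential spectral radius diverge for \<open>r \<le> exp (- s)\<close>.

  To find \<open>f\<close>, conjugate \<open>L\<close> with \<open>\<Prod>\<^sub>k \<beta>\<^sub>k ^ x\<^sub>k\<close>, where \<open>\<beta>\<close> is harmonic for the routing chain off \<open>i\<close>
  and \<open>\<beta>\<^sub>i = \<surd>(\<mu>\<^sub>i / \<nu>\<^sub>i)\<close>. As long as queue \<open>i\<close> is busy this gives \<open>- s\<^sub>i\<close> plus the generator of a twisted
  network, in which a linear function with coefficient 1 at \<open>x\<^sub>i\<close> is a martingale. Minimality of \<open>i\<close> makes
  the remaining queues of the twisted network stable, so they admit an exponential Lyapunov function \<open>W\<close>.
  Up to the conjugating product, \<open>f\<close> is the positive part of a slowly varying bump of the martingale, centred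
  far away from \<open>E\<close>, minus a small multiple of \<open>W\<close>.
\<close>

section \<open>Jump generators\<close>

text \<open>\<open>None\<close> stands for the outside world, so that arrivals, departures and transfers are all moves from
  one point of \<^typ>\<open>'d option\<close> to another.\<close>

definition enabled :: "'d option \<Rightarrow> ('d \<Rightarrow> nat) \<Rightarrow> bool" where
  "enabled k x \<longleftrightarrow> (case k of None \<Rightarrow> True | Some a \<Rightarrow> 0 < x a)"

definition remove_customer :: "'d option \<Rightarrow> ('d \<Rightarrow> nat) \<Rightarrow> 'd \<Rightarrow> nat" where
  "remove_customer k x = (case k of None \<Rightarrow> x | Some a \<Rightarrow> x(a := x a - 1))"

definition add_customer :: "'d option \<Rightarrow> ('d \<Rightarrow> nat) \<Rightarrow> 'd \<Rightarrow> nat" where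
  "add_customer l x = (case l of None \<Rightarrow> x | Some b \<Rightarrow> x(b := Suc (x b)))"

definition move :: "'d option \<Rightarrow> 'd option \<Rightarrow> ('d \<Rightarrow> nat) \<Rightarrow> 'd \<Rightarrow> nat" where
  "move k l x = add_customer l (remove_customer k x)"

definition jump_sum ::
  "('d::finite option \<Rightarrow> 'd option \<Rightarrow> real) \<Rightarrow> ('d \<Rightarrow> nat) \<Rightarrow> ('d option \<Rightarrow> 'd option \<Rightarrow> real) \<Rightarrow> real" where
  "jump_sum q x \<phi> = (\<Sum>k | enabled k x. \<Sum>l\<in>UNIV. q k l * \<phi> k l)"

definition total_rate :: "('d::finite option \<Rightarrow> 'd option \<Rightarrow> real) \<Rightarrow> real" where
  "total_rate q = (\<Sum>k\<in>UNIV. \<Sum>l\<in>UNIV. q k l)"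

definition gen ::
  "('d::finite option \<Rightarrow> 'd option \<Rightarrow> real) \<Rightarrow> (('d \<Rightarrow> nat) \<Rightarrow> real) \<Rightarrow> ('d \<Rightarrow> nat) \<Rightarrow> real" where
  "gen q f x = jump_sum q x (\<lambda>k l. f (move k l x) - f x)"

definition lin :: "('d::finite \<Rightarrow> real) \<Rightarrow> ('d \<Rightarrow> nat) \<Rightarrow> real" where
  "lin c x = (\<Sum>a\<in>UNIV. c a * real (x a))"

definition increment :: "('d \<Rightarrow> real) \<Rightarrow> 'd option \<Rightarrow> 'd option \<Rightarrow> real" where
  "increment c k l = case_option 0 c l - case_option 0 c k"

lemma enabled_simps [simp]: "enabled None x" "enabled (Some a) x \<longleftrightarrow> 0 < x a"
  by (simp_all add: enabled_def)

lemma sum_UNIV_option: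
  fixes f :: "'d::finite option \<Rightarrow> 'b::comm_monoid_add"
  shows "(\<Sum>k\<in>UNIV. f k) = f None + (\<Sum>a\<in>UNIV. f (Some a))"
  by (simp add: UNIV_option_conv sum.reindex)

lemma sum_of_bool_eq_mult:
  fixes f :: "'a \<Rightarrow> 'b::semiring_1"
  assumes "finite A"
  shows "(\<Sum>a\<in>A. of_bool (a = i) * f a) = of_bool (i \<in> A) * f i"
proof -
  have "A \<inter> {a. a = i} = (if i \<in> A then {i} else {})"
    by auto
  then show ?thesis
    using assms by simp
qed

lemma jump_sum_rows:
  "jump_sum q x \<phi> = (\<Sum>l\<in>UNIV. q None l * \<phi> None l)
     + (\<Sum>a | 0 < x a. \<Sum>l\<in>UNIV. q (Some a) l * \<phi> (Some a) l)"
proof -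
  have "enabled k x \<longleftrightarrow> k \<in> insert None (Some ` {a. 0 < x a})" for k
    by (cases k) auto
  then have "{k. enabled k x} = insert None (Some ` {a. 0 < x a})"
    by blast
  then show ?thesis
    by (simp add: jump_sum_def sum.reindex image_iff)
qed

lemma jump_sum_cong:
  assumes "\<And>k l. enabled k x \<Longrightarrow> q k l * \<phi> k l = q' k l * \<phi>' k l"
  shows "jump_sum q x \<phi> = jump_sum q' x \<phi>'"
  unfolding jump_sum_def using assms by (intro sum.cong) auto

lemma jump_sum_mono:
  assumes "\<And>k l. 0 \<le> q k l" "\<And>k l. enabled k x \<Longrightarrow> \<phi> k l \<le> \<phi>' k l"
  shows "jump_sum q x \<phi> \<le> jump_sum q x \<phi>'"
  unfolding jump_sum_def using assms by (intro sum_mono mult_left_mono) auto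

lemma jump_sum_add: "jump_sum q x (\<lambda>k l. \<phi> k l + \<phi>' k l) = jump_sum q x \<phi> + jump_sum q x \<phi>'"
  by (simp add: jump_sum_def distrib_left sum.distrib)

lemma jump_sum_diff: "jump_sum q x (\<lambda>k l. \<phi> k l - \<phi>' k l) = jump_sum q x \<phi> - jump_sum q x \<phi>'"
  by (simp add: jump_sum_def right_diff_distrib sum_subtractf)

lemma jump_sum_cmult: "jump_sum q x (\<lambda>k l. a * \<phi> k l) = a * jump_sum q x \<phi>"
  by (simp add: jump_sum_def sum_distrib_left mult.left_commute)

lemma jump_sum_sum: "jump_sum q x (\<lambda>k l. \<Sum>j\<in>J. \<phi> j k l) = (\<Sum>j\<in>J. jump_sum q x (\<phi> j))"
  unfolding jump_sum_def sum_distrib_left by (simp add: sum.swap[where B=J])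

lemma jump_sum_nonneg:
  assumes "\<And>k l. 0 \<le> q k l" "\<And>k l. 0 \<le> \<phi> k l"
  shows "0 \<le> jump_sum q x \<phi>"
  unfolding jump_sum_def using assms by (intro sum_nonneg mult_nonneg_nonneg)

lemma jump_sum_le_total:
  assumes "\<And>k l. 0 \<le> q k l" "0 \<le> B" "\<And>k l. enabled k x \<Longrightarrow> \<phi> k l \<le> B"
  shows "jump_sum q x \<phi> \<le> B * total_rate q"
proof -
  have "jump_sum q x \<phi> \<le> jump_sum q x (\<lambda>_ _. B)"
    using assms(1,3) by (rule jump_sum_mono)
  also have "\<dots> = B * (\<Sum>k | enabled k x. \<Sum>l\<in>UNIV. q k l)"
    by (simp add: jump_sum_def sum_distrib_left mult.commute)
  also have "\<dots> \<le> B * total_rate q"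
    unfolding total_rate_def using assms by (intro mult_left_mono sum_mono2 sum_nonneg) auto
  finally show ?thesis .
qed

lemma gen_mono_at:
  assumes "\<And>k l. 0 \<le> q k l" "\<And>y. f y \<le> g y" "f x = g x"
  shows "gen q f x \<le> gen q g x"
  unfolding gen_def using assms by (intro jump_sum_mono) auto

lemma gen_diff: "gen q (\<lambda>z. f z - g z) x = gen q f x - gen q g x"
  unfolding gen_def jump_sum_diff[symmetric] by (simp add: algebra_simps)

lemma gen_cmult: "gen q (\<lambda>z. a * f z) x = a * gen q f x"
  unfolding gen_def jump_sum_cmult[symmetric] by (simp add: algebra_simps)

lemma gen_sum: "gen q (\<lambda>z. \<Sum>j\<in>J. f j z) x = (\<Sum>j\<in>J. gen q (f j) x)"
  unfolding gen_def jump_sum_sum[symmetric] sum_subtractf ..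

lemma lin_add_single: "lin c (x(a := Suc (x a))) = lin c x + c a"
proof -
  have "lin c (x(a := Suc (x a))) = (\<Sum>b\<in>UNIV. c b * real (x b) + (if b = a then c a else 0))"
    unfolding lin_def by (intro sum.cong) (auto simp: algebra_simps)
  then show ?thesis
    by (simp add: lin_def sum.distrib)
qed

lemma lin_move:
  assumes "enabled k x"
  shows "lin c (move k l x) = lin c x + increment c k l"
proof -
  have "lin c (remove_customer k x) = lin c x - case_option 0 c k"
  proof (cases k)
    case (Some a)
    then show ?thesis
      using lin_add_single[of c "x(a := x a - 1)" a] assms by (simp add: remove_customer_def)
  qed (simp add: remove_customer_def)
  moreover have "lin c (add_customer l y) = lin c y + case_option 0 c l" for y
    by (cases l) (simp_all add: add_customer_def lin_add_single)
  ultimately show ?thesis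
    by (simp add: move_def increment_def)
qed

lemma gen_lin: "gen q (lin c) x = jump_sum q x (increment c)"
  unfolding gen_def by (intro jump_sum_cong) (simp add: lin_move)

lemma abs_increment_le:
  assumes "\<And>a. \<bar>c a\<bar> \<le> B"
  shows "\<bar>increment c k l\<bar> \<le> 2 * B"
proof -
  have "\<bar>case_option 0 c k\<bar> \<le> B" for k
    using assms order_trans[OF abs_ge_zero assms] by (cases k) auto
  from this[of k] this[of l] show ?thesis
    unfolding increment_def by linarith
qed

lemma prod_power_move:
  fixes \<beta> :: "'d::finite \<Rightarrow> real"
  assumes "\<And>a. 0 < \<beta> a" "enabled k x"
  shows "(\<Prod>a\<in>UNIV. \<beta> a ^ move k l x a)
     = (\<Prod>a\<in>UNIV. \<beta> a ^ x a) * (case_option 1 \<beta> l / case_option 1 \<beta> k)"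
proof -
  have exp_lin: "(\<Prod>a\<in>UNIV. \<beta> a ^ y a) = exp (lin (\<lambda>a. ln (\<beta> a)) y)" for y
    unfolding lin_def by (simp add: exp_sum exp_of_nat2_mult assms)
  have exp_ln: "exp (case_option 0 (\<lambda>a. ln (\<beta> a)) m) = case_option 1 \<beta> m" for m
    by (cases m) (simp_all add: assms)
  show ?thesis
    unfolding exp_lin lin_move[OF assms(2)] exp_add increment_def exp_diff exp_ln ..
qed

lemma gen_conjugate:
  assumes "\<And>k l. enabled k x \<Longrightarrow> F (move k l x) = F x * r k l"
  shows "gen q (\<lambda>z. F z * \<psi> z) x
    = F x * (gen (\<lambda>k l. q k l * r k l) \<psi> x + jump_sum q x (\<lambda>k l. r k l - 1) * \<psi> x)"
proof -
  have "gen (\<lambda>k l. q k l * r k l) \<psi> x = jump_sum q x (\<lambda>k l. r k l * (\<psi> (move k l x) - \<psi> x))"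
    unfolding gen_def by (intro jump_sum_cong) (simp add: mult.assoc)
  moreover have "gen q (\<lambda>z. F z * \<psi> z) x = jump_sum q x (\<lambda>k l.
      F x * (r k l * (\<psi> (move k l x) - \<psi> x)) + (F x * \<psi> x) * (r k l - 1))"
    unfolding gen_def by (intro jump_sum_cong) (simp add: assms algebra_simps)
  ultimately show ?thesis
    by (simp only: jump_sum_add jump_sum_cmult) (simp add: algebra_simps)
qed

section \<open>Sub-eigenfunctions bound the essential spectral radius\<close>

lemma suminf_ennreal_poisson:
  fixes u v t :: real
  assumes "0 \<le> u" "0 \<le> v" "0 \<le> t"
  shows "(\<Sum>n. ennreal (exp (- u * t) * (u * t) ^ n / fact n) * ennreal (v ^ n))
    = ennreal (exp (u * (v - 1) * t))"
proof -
  have "(\<lambda>n. exp (- u * t) * ((u * t * v) ^ n /\<^sub>R fact n)) sums (exp (- u * t) * exp (u * t * v))"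
    by (intro sums_mult exp_converges)
  then have "(\<lambda>n. exp (- u * t) * (u * t) ^ n / fact n * v ^ n) sums exp (u * (v - 1) * t)"
    by (simp add: exp_add[symmetric] algebra_simps power_mult_distrib divide_inverse)
  then have "(\<Sum>n. ennreal (exp (- u * t) * (u * t) ^ n / fact n * v ^ n))
      = ennreal (exp (u * (v - 1) * t))"
    using assms by (intro suminf_ennreal_eq) auto
  then show ?thesis
    using assms by (simp flip: ennreal_mult)
qed

lemma emeasure_lborel_atLeast: "emeasure lborel {a::real..} = \<infinity>"
proof (rule ccontr)
  assume "emeasure lborel {a..} \<noteq> \<infinity>"
  then obtain n :: nat where "emeasure lborel {a..} < of_nat n"
    using ennreal_Ex_less_of_nat by (auto simp: less_top)
  moreover have "emeasure lborel {a..a + real n} \<le> emeasure lborel {a..}"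
    by (rule emeasure_mono) auto
  ultimately show False
    by (simp add: ennreal_of_nat_eq_real_of_nat)
qed

locale jackson_parameters =
  fixes lam mu :: "'d::finite \<Rightarrow> real" and P :: "real^'d^'d"
  assumes lam_nonneg: "0 \<le> lam i"
    and mu_pos: "0 < mu i"
    and P_nonneg: "0 \<le> P$i$j"
    and P_diag: "P$i$i = 0"
    and P_substoch: "(\<Sum>j\<in>UNIV. P$i$j) \<le> 1"
begin

abbreviation unif_rate :: real where
  "unif_rate \<equiv> unif_const lam mu"

abbreviation kernel :: "('d \<Rightarrow> nat) \<Rightarrow> ('d \<Rightarrow> nat) \<Rightarrow> real" where
  "kernel \<equiv> unif_kernel lam mu P"

abbreviation taboo :: "('d \<Rightarrow> nat) set \<Rightarrow> nat \<Rightarrow> ('d \<Rightarrow> nat) \<Rightarrow> ('d \<Rightarrow> nat) \<Rightarrow> ennreal" where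
  "taboo \<equiv> taboo_steps lam mu P"

definition rate :: "'d option \<Rightarrow> 'd option \<Rightarrow> real" where
  "rate k l = (case k of None \<Rightarrow> case_option 0 lam l
      | Some a \<Rightarrow> mu a * (case l of None \<Rightarrow> p0 P a | Some b \<Rightarrow> P$a$b))"

lemma rate_simps [simp]:
  "rate None None = 0" "rate None (Some b) = lam b"
  "rate (Some a) None = mu a * p0 P a" "rate (Some a) (Some b) = mu a * P$a$b"
  by (simp_all add: rate_def)

lemma p0_nonneg: "0 \<le> p0 P a"
  using P_substoch[of a] by (simp add: p0_def)

lemma p0_sum: "p0 P a + (\<Sum>b\<in>UNIV. P$a$b) = 1"
  by (simp add: p0_def)

lemma rate_nonneg: "0 \<le> rate k l"
  by (cases k; cases l) (simp_all add: lam_nonneg mu_pos P_nonneg p0_nonneg less_imp_le)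

lemma sum_rate_service_row: "(\<Sum>l\<in>UNIV. rate (Some a) l) = mu a"
  using p0_sum[of a] by (simp add: sum_UNIV_option flip: sum_distrib_left distrib_left)

lemma sum_rate_arrivals: "(\<Sum>l\<in>UNIV. rate None l * f l) = (\<Sum>a\<in>UNIV. lam a * f (Some a))"
  by (simp add: sum_UNIV_option)

lemma sum_rate_services:
  "(\<Sum>l\<in>UNIV. rate (Some a) l * f l) = mu a * (p0 P a * f None + (\<Sum>c\<in>UNIV. P$a$c * f (Some c)))"
  by (simp add: sum_UNIV_option distrib_left sum_distrib_left mult.assoc)

lemma jrate_eq_jump_sum: "jrate lam mu P x y = jump_sum rate x (\<lambda>k l. of_bool (y = move k l x))"
proof -
  have transfers: "(\<Sum>j\<in>UNIV. if j \<noteq> i \<and> 0 < x i \<and> y = (x(i := x i - 1))(j := x j + 1)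
          then mu i * P$i$j else 0)
      = (\<Sum>j\<in>UNIV. rate (Some i) (Some j) * of_bool (y = move (Some i) (Some j) x))" if "0 < x i" for i
    using that by (intro sum.cong) (auto simp: P_diag move_def add_customer_def remove_customer_def)
  have "jrate lam mu P x y = (\<Sum>i\<in>UNIV. rate None (Some i) * of_bool (y = move None (Some i) x))
      + (\<Sum>i\<in>UNIV. if 0 < x i then \<Sum>l\<in>UNIV. rate (Some i) l * of_bool (y = move (Some i) l x) else 0)"
    unfolding jrate_def sum.distrib[symmetric]
  proof (intro sum.cong refl)
    fix i
    show "(if y = x(i := x i + 1) then lam i else 0)
        + (if 0 < x i \<and> y = x(i := x i - 1) then mu i * p0 P i else 0)
        + (\<Sum>j\<in>UNIV. if j \<noteq> i \<and> 0 < x i \<and> y = (x(i := x i - 1))(j := x j + 1) then mu i * P$i$j else 0)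
      = rate None (Some i) * of_bool (y = move None (Some i) x)
        + (if 0 < x i then \<Sum>l\<in>UNIV. rate (Some i) l * of_bool (y = move (Some i) l x) else 0)"
      using transfers[of i]
      by (auto simp: sum_UNIV_option move_def add_customer_def remove_customer_def)
  qed
  then show ?thesis
    by (simp add: jump_sum_rows sum_UNIV_option[of "\<lambda>l. rate None l * _ l"] flip: sum.inter_filter)
qed

lemma outrate_eq_jump_sum: "outrate lam mu P x = jump_sum rate x (\<lambda>_ _. 1)"
proof -
  have "p0 P i + (\<Sum>j\<in>UNIV - {i}. P$i$j) = 1" for i
    using p0_sum[of i] by (simp add: sum_diff1 P_diag)
  then show ?thesis
    by (simp add: outrate_def jump_sum_rows sum_rate_service_row sum_UNIV_option[of "rate None"]
        sum.distrib flip: sum.inter_filter cong: if_cong)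
qed

lemma unif_const_pos: "0 < unif_rate"
  unfolding unif_const_def
  by (intro add_pos_nonneg sum_nonneg) (simp_all add: lam_nonneg mu_pos less_imp_le)

lemma outrate_le: "outrate lam mu P x \<le> unif_rate"
proof -
  have "outrate lam mu P x = (\<Sum>i\<in>UNIV. lam i) + (\<Sum>i | 0 < x i. mu i)"
    unfolding outrate_eq_jump_sum jump_sum_rows
    by (simp add: sum_rate_service_row sum_UNIV_option[of "rate None"])
  also have "\<dots> \<le> (\<Sum>i\<in>UNIV. lam i) + (\<Sum>i\<in>UNIV. mu i)"
    by (intro add_left_mono sum_mono2) (simp_all add: mu_pos less_imp_le)
  finally show ?thesis
    by (simp add: unif_const_def)
qed

lemma unif_kernel_nonneg: "0 \<le> kernel x y"
proof -
  have "0 \<le> jrate lam mu P x y"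
    unfolding jrate_eq_jump_sum by (rule jump_sum_nonneg) (simp_all add: rate_nonneg)
  then show ?thesis
    using outrate_le[of x] unif_const_pos by (simp add: unif_kernel_def)
qed

lemma sum_unif_kernel:
  assumes "finite S" "\<And>z. z \<notin> S \<Longrightarrow> f z = 0"
  shows "(\<Sum>z\<in>S. kernel x z * f z) = f x + gen rate f x / unif_rate"
proof -
  have point: "(\<Sum>z\<in>S. of_bool (z = a) * f z) = f a" for a
    unfolding sum_of_bool_eq_mult[OF assms(1)] using assms(2) by (cases "a \<in> S") simp_all
  have "(\<Sum>z\<in>S. jrate lam mu P x z * f z)
      = (\<Sum>z\<in>S. jump_sum rate x (\<lambda>k l. of_bool (z = move k l x) * f z))"
    unfolding jrate_eq_jump_sum by (simp add: mult.commute[of _ "f _"] jump_sum_cmult)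
  also have "\<dots> = jump_sum rate x (\<lambda>k l. f (move k l x))"
    unfolding jump_sum_sum[symmetric] point ..
  finally have "(\<Sum>z\<in>S. jrate lam mu P x z * f z) - outrate lam mu P x * f x = gen rate f x"
    unfolding gen_def jump_sum_diff outrate_eq_jump_sum
    using jump_sum_cmult[of rate x "f x" "\<lambda>_ _. 1"] by (simp add: mult.commute)
  moreover have "kernel x z * f z = jrate lam mu P x z * f z / unif_rate
      + (1 - outrate lam mu P x / unif_rate) * (of_bool (z = x) * f z)" for z
    by (simp add: unif_kernel_def distrib_right)
  then have "(\<Sum>z\<in>S. kernel x z * f z) = (\<Sum>z\<in>S. jrate lam mu P x z * f z) / unif_rate
      + (1 - outrate lam mu P x / unif_rate) * f x"
    by (simp only: sum.distrib sum_divide_distrib sum_distrib_left[symmetric] point)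
  ultimately show ?thesis
    using unif_const_pos by (simp add: field_simps)
qed

lemma nn_integral_unif_kernel: "(\<integral>\<^sup>+z. ennreal (kernel x z) \<partial>count_space UNIV) = 1"
proof -
  define T where "T = insert x ((\<lambda>(k, l). move k l x) ` UNIV)"
  have finite_T: "finite T" and x_in_T: "x \<in> T" and move_in_T: "move k l x \<in> T" for k l
    unfolding T_def by auto
  have "kernel x z = 0" if "z \<notin> T" for z
  proof -
    have "jrate lam mu P x z = 0"
      unfolding jrate_eq_jump_sum jump_sum_def using that move_in_T by (intro sum.neutral ballI) auto
    then show ?thesis
      using that x_in_T by (auto simp: unif_kernel_def)
  qed
  then have "(\<integral>\<^sup>+z. ennreal (kernel x z) \<partial>count_space UNIV) = ennreal (\<Sum>z\<in>T. kernel x z)"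
    by (subst nn_integral_count_space'[OF finite_T]) (auto simp: unif_kernel_nonneg)
  moreover have "(\<Sum>z\<in>T. kernel x z * of_bool (z \<in> T)) = 1"
    by (subst sum_unif_kernel[OF finite_T]) (simp_all add: gen_def jump_sum_def x_in_T move_in_T)
  ultimately show ?thesis
    by (simp add: Int_absorb2)
qed

lemma taboo_steps_le_1: "taboo E n x y \<le> 1"
proof (induction n arbitrary: x)
  case (Suc n)
  have "ennreal (kernel x z) * indicator (- E) z * taboo E n z y \<le> ennreal (kernel x z)" for z
    using mult_left_mono[OF Suc.IH, of "ennreal (kernel x z)" z] by (simp add: indicator_def)
  then show ?case
    unfolding taboo_steps.simps nn_integral_unif_kernel[of x, symmetric] by (rule nn_integral_mono)
qed simp

lemma taboo_prob_le_1:
  assumes "0 \<le> t"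
  shows "taboo_prob lam mu P E t x y \<le> 1"
proof -
  have "taboo_prob lam mu P E t x y
      \<le> (\<Sum>n. ennreal (exp (- unif_rate * t) * (unif_rate * t) ^ n / fact n) * ennreal (1 ^ n))"
    unfolding taboo_prob_def by (intro suminf_le mult_left_mono) (simp_all add: taboo_steps_le_1)
  also have "\<dots> = ennreal (exp (unif_rate * (1 - 1) * t))"
    by (rule suminf_ennreal_poisson) (use unif_const_pos assms in auto)
  finally show ?thesis
    by simp
qed

definition sub_eigenfunction :: "real \<Rightarrow> (('d \<Rightarrow> nat) \<Rightarrow> real) \<Rightarrow> bool" where
  "sub_eigenfunction s f \<longleftrightarrow> finite {z. f z \<noteq> 0} \<and> (\<forall>z. 0 \<le> f z) \<and> (\<forall>x. - s * f x \<le> gen rate f x)"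

lemma sub_eigenfunction_kernel_ge:
  assumes "sub_eigenfunction s f"
  shows "max 0 (1 - s / unif_rate) * f x \<le> (\<Sum>z | f z \<noteq> 0. kernel x z * f z)"
proof -
  have f: "finite {z. f z \<noteq> 0}" "0 \<le> f z" "- s * f x \<le> gen rate f x" for z
    using assms by (simp_all add: sub_eigenfunction_def)
  have "(1 - s / unif_rate) * f x = f x + - s * f x / unif_rate"
    by (simp add: algebra_simps)
  also have "\<dots> \<le> f x + gen rate f x / unif_rate"
    using f(3) unif_const_pos by (intro add_left_mono divide_right_mono) auto
  also have "\<dots> = (\<Sum>z | f z \<noteq> 0. kernel x z * f z)"
    by (rule sum_unif_kernel[symmetric]) (simp_all add: f)
  finally have "(1 - s / unif_rate) * f x \<le> (\<Sum>z | f z \<noteq> 0. kernel x z * f z)" .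
  moreover have "0 \<le> (\<Sum>z | f z \<noteq> 0. kernel x z * f z)"
    by (intro sum_nonneg mult_nonneg_nonneg unif_kernel_nonneg f)
  ultimately show ?thesis
    by (simp add: max_def)
qed

lemma taboo_steps_sum_ge:
  assumes f: "sub_eigenfunction s f" and vanish: "\<And>z. z \<in> E \<Longrightarrow> f z = 0"
  shows "ennreal (max 0 (1 - s / unif_rate) ^ n) * ennreal (f x)
      \<le> (\<Sum>y | f y \<noteq> 0. taboo E n x y * ennreal (f y))"
proof (induction n arbitrary: x)
  case 0
  have finite_support: "finite {y. f y \<noteq> 0}"
    using f by (simp add: sub_eigenfunction_def)
  have "(\<Sum>y | f y \<noteq> 0. taboo E 0 x y * ennreal (f y))
      = (\<Sum>y | f y \<noteq> 0. if y = x then ennreal (f x) else 0)"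
    by (intro sum.cong) auto
  then show ?case
    using finite_support by simp
next
  case (Suc n)
  define c where "c = max 0 (1 - s / unif_rate)"
  define S where "S = {z. f z \<noteq> 0}"
  have "finite S" and f_nonneg: "0 \<le> f z" and c: "0 \<le> c" for z
    using f by (simp_all add: sub_eigenfunction_def S_def c_def)
  have "ennreal (c ^ Suc n) * ennreal (f x) = ennreal (c ^ n * (c * f x))"
    using c f_nonneg by (simp add: ennreal_mult'[symmetric] algebra_simps)
  also have "\<dots> \<le> ennreal (c ^ n * (\<Sum>z\<in>S. kernel x z * f z))"
    unfolding c_def S_def using f by (intro ennreal_leI mult_left_mono sub_eigenfunction_kernel_ge) auto
  also have "\<dots> = (\<Sum>z\<in>S. ennreal (c ^ n * (kernel x z * f z)))"
    using c f_nonneg unif_kernel_nonneg by (simp add: sum_distrib_left)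
  also have "\<dots> = (\<Sum>z\<in>S. ennreal (kernel x z) * indicator (- E) z * (ennreal (c ^ n) * ennreal (f z)))"
    using c f_nonneg unif_kernel_nonneg vanish
    by (intro sum.cong) (auto simp: S_def ennreal_mult indicator_def mult.left_commute)
  also have "\<dots> = (\<integral>\<^sup>+z. ennreal (kernel x z) * indicator (- E) z * (ennreal (c ^ n) * ennreal (f z))
      \<partial>count_space UNIV)"
    by (rule nn_integral_count_space'[symmetric]) (use \<open>finite S\<close> in \<open>auto simp: S_def\<close>)
  also have "\<dots> \<le> (\<integral>\<^sup>+z. ennreal (kernel x z) * indicator (- E) z
       * (\<Sum>y\<in>S. taboo E n z y * ennreal (f y)) \<partial>count_space UNIV)"
    unfolding c_def S_def by (intro nn_integral_mono mult_left_mono Suc.IH) auto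
  also have "\<dots> = (\<Sum>y\<in>S. taboo E (Suc n) x y * ennreal (f y))"
    by (simp add: sum_distrib_left nn_integral_sum nn_integral_multc flip: mult.assoc)
  finally show ?case
    unfolding c_def S_def .
qed

lemma taboo_prob_sum_ge:
  assumes f: "sub_eigenfunction s f" and vanish: "\<And>z. z \<in> E \<Longrightarrow> f z = 0" and t: "0 \<le> t"
  shows "ennreal (exp (- s * t)) * ennreal (f x)
    \<le> (\<Sum>y | f y \<noteq> 0. taboo_prob lam mu P E t x y * ennreal (f y))"
proof -
  let ?p = "\<lambda>n. ennreal (exp (- unif_rate * t) * (unif_rate * t) ^ n / fact n)"
  define c where "c = max 0 (1 - s / unif_rate)"
  have "unif_rate * (1 - s / unif_rate) \<le> unif_rate * c"
    using unif_const_pos unfolding c_def by (intro mult_left_mono) auto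
  then have "- s \<le> unif_rate * (c - 1)"
    using unif_const_pos by (simp add: algebra_simps)
  then have "ennreal (exp (- s * t)) \<le> ennreal (exp (unif_rate * (c - 1) * t))"
    using mult_right_mono[of "- s" "unif_rate * (c - 1)" t] t by (intro ennreal_leI) simp
  also have "\<dots> = (\<Sum>n. ?p n * ennreal (c ^ n))"
    by (rule suminf_ennreal_poisson[symmetric]) (use unif_const_pos t in \<open>auto simp: c_def\<close>)
  finally have "ennreal (exp (- s * t)) * ennreal (f x) \<le> (\<Sum>n. ?p n * ennreal (c ^ n)) * ennreal (f x)"
    by (rule mult_right_mono) simp
  also have "\<dots> = (\<Sum>n. ?p n * (ennreal (c ^ n) * ennreal (f x)))"
    by (simp only: ennreal_suminf_multc[symmetric] mult.assoc)
  also have "\<dots> \<le> (\<Sum>n. ?p n * (\<Sum>y | f y \<noteq> 0. taboo E n x y * ennreal (f y)))"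
    unfolding c_def by (intro suminf_le mult_left_mono taboo_steps_sum_ge f vanish) auto
  also have "\<dots> = (\<Sum>y | f y \<noteq> 0. taboo_prob lam mu P E t x y * ennreal (f y))"
    unfolding taboo_prob_def by (simp add: sum_distrib_left suminf_sum flip: mult.assoc)
  finally show ?thesis .
qed

definition taboo_resolvent :: "real \<Rightarrow> ('d \<Rightarrow> nat) set \<Rightarrow> ('d \<Rightarrow> nat) \<Rightarrow> ('d \<Rightarrow> nat) \<Rightarrow> ennreal" where
  "taboo_resolvent r E x y =
     (\<integral>\<^sup>+ t. indicator {0..} t * ennreal (r powr (- t)) * taboo_prob lam mu P E t x y \<partial>lborel)"

lemma borel_measurable_taboo_prob [measurable]:
  "(\<lambda>t. taboo_prob lam mu P E t x y) \<in> borel_measurable borel"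
  unfolding taboo_prob_def by measurable

lemma taboo_resolvent_less_top:
  assumes "1 < r"
  shows "taboo_resolvent r E x y < \<infinity>"
proof -
  let ?G = "\<lambda>t. - exp (- ln r * t) / ln r"
  have "taboo_resolvent r E x y \<le> (\<integral>\<^sup>+ t. ennreal (exp (- ln r * t)) * indicator {0..} t \<partial>lborel)"
    unfolding taboo_resolvent_def
  proof (rule nn_integral_mono)
    fix t :: real
    show "indicator {0..} t * ennreal (r powr (- t)) * taboo_prob lam mu P E t x y
        \<le> ennreal (exp (- ln r * t)) * indicator {0..} t"
    proof (cases "0 \<le> t")
      case True
      then show ?thesis
        using mult_left_mono[OF taboo_prob_le_1[OF True]] assms by (simp add: powr_def mult.commute)
    qed simp
  qed
  also have "\<dots> = ennreal (0 - ?G 0)"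
  proof (rule nn_integral_FTC_atLeast)
    have "LIM t at_top. - ln r * t :> at_bot"
      using assms
      by (intro filterlim_tendsto_neg_mult_at_bot[OF tendsto_const]) (auto simp: filterlim_ident)
    then show "(?G \<longlongrightarrow> 0) at_top"
      using assms
        tendsto_divide[OF tendsto_minus[OF filterlim_compose[OF exp_at_bot]] tendsto_const, of _ _ "ln r"]
      by fastforce
  qed (use assms in \<open>auto intro!: derivative_eq_intros\<close>)
  finally show ?thesis
    by (rule le_less_trans) (simp add: ennreal_less_top)
qed

lemma taboo_resolvent_sum_eq_top:
  assumes f: "sub_eigenfunction s f" and vanish: "\<And>z. z \<in> E \<Longrightarrow> f z = 0"
    and r: "0 < r" "r \<le> exp (- s)" and x: "f x \<noteq> 0"
  shows "(\<Sum>y | f y \<noteq> 0. taboo_resolvent r E x y * ennreal (f y)) = \<infinity>"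
proof -
  let ?g = "\<lambda>y t. indicator {0..} t * ennreal (r powr (- t)) * taboo_prob lam mu P E t x y"
  have lower: "ennreal (f x) * indicator {0..} t \<le> (\<Sum>y | f y \<noteq> 0. ?g y t * ennreal (f y))" for t :: real
  proof (cases "0 \<le> t")
    case True
    have "ln r \<le> - s"
      using r by (simp add: ln_le_cancel_iff[symmetric])
    then have "1 \<le> r powr (- t) * exp (- s * t)"
      using r True mult_right_mono[of "ln r" "- s" t] by (simp add: powr_def exp_add[symmetric] mult.commute)
    then have "1 * ennreal (f x) \<le> (ennreal (r powr (- t)) * ennreal (exp (- s * t))) * ennreal (f x)"
      by (intro mult_right_mono) (simp_all add: ennreal_mult[symmetric])
    also have "\<dots> \<le> ennreal (r powr (- t)) * (\<Sum>y | f y \<noteq> 0. taboo_prob lam mu P E t x y * ennreal (f y))"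
      unfolding mult.assoc using f vanish True by (intro mult_left_mono taboo_prob_sum_ge) auto
    finally show ?thesis
      using True by (simp add: sum_distrib_left mult.assoc)
  qed simp
  have "0 < f x"
    using f x by (simp add: sub_eigenfunction_def order_less_le)
  then have "\<infinity> = (\<integral>\<^sup>+t. ennreal (f x) * indicator {0::real..} t \<partial>lborel)"
    by (simp add: nn_integral_cmult_indicator emeasure_lborel_atLeast ennreal_mult_top)
  also have "\<dots> \<le> (\<integral>\<^sup>+t. (\<Sum>y | f y \<noteq> 0. ?g y t * ennreal (f y)) \<partial>lborel)"
    by (intro nn_integral_mono lower)
  also have "\<dots> = (\<Sum>y | f y \<noteq> 0. taboo_resolvent r E x y * ennreal (f y))"
    by (simp add: nn_integral_sum nn_integral_multc taboo_resolvent_def)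
  finally show ?thesis
    by (simp add: top.extremum_unique)
qed

lemma exp_le_ess_spec_radius:
  assumes test: "\<And>E. finite E \<Longrightarrow> \<exists>f. sub_eigenfunction s f \<and> (\<forall>z\<in>E. f z = 0) \<and> (\<exists>x. f x \<noteq> 0)"
  shows "exp (- s) \<le> ess_spec_radius lam mu P"
  unfolding ess_spec_radius_def taboo_resolvent_def[symmetric]
proof (rule cInf_greatest)
  show "{r. 0 < r \<and> (\<exists>E. finite E \<and> (\<forall>x y. x \<notin> E \<longrightarrow> y \<notin> E \<longrightarrow> taboo_resolvent r E x y < \<infinity>))} \<noteq> {}"
    using taboo_resolvent_less_top[of 2 "{}"] by (auto intro!: exI[of _ 2] exI[of _ "{}"])
next
  fix r
  assume "r \<in> {r. 0 < r \<and> (\<exists>E. finite E \<and> (\<forall>x y. x \<notin> E \<longrightarrow> y \<notin> E \<longrightarrow> taboo_resolvent r E x y < \<infinity>))}"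
  then obtain E where "0 < r" "finite E"
    and finite_resolvent: "\<And>x y. x \<notin> E \<Longrightarrow> y \<notin> E \<Longrightarrow> taboo_resolvent r E x y < \<infinity>"
    by blast
  obtain f x where f: "sub_eigenfunction s f" "\<And>z. z \<in> E \<Longrightarrow> f z = 0" and x: "f x \<noteq> 0"
    using test[OF \<open>finite E\<close>] by blast
  have "taboo_resolvent r E x y * ennreal (f y) < \<infinity>" if "f y \<noteq> 0" for y
    using finite_resolvent[of x y] f(2) x that by (auto simp: ennreal_mult_less_top)
  then have "(\<Sum>y | f y \<noteq> 0. taboo_resolvent r E x y * ennreal (f y)) < \<infinity>"
    using f(1) by (simp add: sub_eigenfunction_def less_top)
  then show "exp (- s) \<le> r"
    using taboo_resolvent_sum_eq_top[OF f \<open>0 < r\<close> _ x] by force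
qed

end

section \<open>A test function from a martingale and a Lyapunov function\<close>

definition qvar :: "('d::finite option \<Rightarrow> 'd option \<Rightarrow> real) \<Rightarrow> ('d \<Rightarrow> real) \<Rightarrow> ('d \<Rightarrow> nat) \<Rightarrow> real" where
  "qvar q c x = jump_sum q x (\<lambda>k l. (increment c k l)\<^sup>2)"

lemma gen_ge_of_quadratic:
  assumes "\<And>k l. 0 \<le> q k l"
    and "\<And>k l. enabled k x \<Longrightarrow> A * increment c k l + B * (increment c k l)\<^sup>2 \<le> f (move k l x) - f x"
  shows "A * gen q (lin c) x + B * qvar q c x \<le> gen q f x"
  unfolding gen_lin qvar_def gen_def[of q f] jump_sum_cmult[symmetric] jump_sum_add[symmetric]
  using assms by (rule jump_sum_mono)

lemma gen_le_of_quadratic: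
  assumes "\<And>k l. 0 \<le> q k l"
    and "\<And>k l. enabled k x \<Longrightarrow> f (move k l x) - f x \<le> A * increment c k l + B * (increment c k l)\<^sup>2"
  shows "gen q f x \<le> A * gen q (lin c) x + B * qvar q c x"
  unfolding gen_lin qvar_def gen_def[of q f] jump_sum_cmult[symmetric] jump_sum_add[symmetric]
  using assms by (rule jump_sum_mono)

lemma qvar_ge_arrivals:
  assumes "\<And>k l. 0 \<le> q k l"
  shows "(\<Sum>l\<in>UNIV. q None l * (increment c None l)\<^sup>2) \<le> qvar q c x"
  unfolding qvar_def jump_sum_rows by (simp add: assms sum_nonneg)

lemma qvar_le:
  assumes "\<And>k l. 0 \<le> q k l" "\<And>k l. \<bar>increment c k l\<bar> \<le> M"
  shows "qvar q c x \<le> M\<^sup>2 * total_rate q"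
proof -
  have "0 \<le> M"
    using order_trans[OF abs_ge_zero assms(2)] .
  then show ?thesis
    unfolding qvar_def using assms by (intro jump_sum_le_total) (simp_all add: power2_le_iff_abs_le)
qed

lemma quartic_increment_ge:
  fixes t h \<theta> :: real
  assumes "\<bar>t\<bar> \<le> 1" "\<bar>h\<bar> \<le> \<theta>"
  shows "(4 * t ^ 3 - 4 * t) * h + (6 * t\<^sup>2 - 2 - 4 * \<theta>) * h\<^sup>2 \<le> ((t + h)\<^sup>2 - 1)\<^sup>2 - (t\<^sup>2 - 1)\<^sup>2"
proof -
  have "\<bar>t * h\<bar> \<le> 1 * \<theta>"
    unfolding abs_mult by (intro mult_mono assms) auto
  then have "0 \<le> \<theta> + t * h"
    by linarith
  then have "0 \<le> h\<^sup>2 * (4 * (\<theta> + t * h) + h\<^sup>2)"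
    by simp
  also have "\<dots> = ((t + h)\<^sup>2 - 1)\<^sup>2 - (t\<^sup>2 - 1)\<^sup>2 - ((4 * t ^ 3 - 4 * t) * h + (6 * t\<^sup>2 - 2 - 4 * \<theta>) * h\<^sup>2)"
    by (simp add: power2_eq_square power3_eq_cube algebra_simps)
  finally show ?thesis
    by simp
qed

lemma quartic_outside_le:
  fixes t :: real
  assumes "1 \<le> \<bar>t\<bar>" "\<bar>t\<bar> \<le> 9/8"
  shows "(t\<^sup>2 - 1)\<^sup>2 \<le> 1/8"
proof -
  have "1 \<le> t\<^sup>2" "t\<^sup>2 \<le> (9/8)\<^sup>2"
    using power_mono[OF assms(1), of 2] power_mono[OF assms(2), of 2] by simp_all
  then have "(t\<^sup>2 - 1)\<^sup>2 \<le> (17/64)\<^sup>2"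
    by (intro power_mono) (simp_all add: power2_eq_square)
  then show ?thesis
    by (simp add: power2_eq_square)
qed

text \<open>Here \<open>u\<close> is \<open>t\<^sup>2\<close>, \<open>v\<close> the quadratic variation of \<open>t\<close>, \<open>w\<close> the multiple of the Lyapunov function
  and \<open>g\<close> the generator applied to \<open>(t\<^sup>2 - 1)\<^sup>2 - 1/8 - w\<close>. For \<open>u \<ge> 1/2\<close> convexity makes \<open>g \<ge> 0\<close>, for large
  \<open>w\<close> the Lyapunov drift does, and otherwise the function itself is at least \<open>1/16\<close>.\<close>
lemma quartic_drift_ge:
  fixes \<theta> u v w g \<sigma> \<kappa> \<epsilon> :: real
  assumes drift: "(6 * u - 2 - 4 * \<theta>) * v - \<sigma> / 2 + \<kappa> * w \<le> g"
    and "\<theta> \<le> 1/8" "0 \<le> u" "0 \<le> \<sigma>" "\<sigma> \<le> v" "0 \<le> w" "0 < \<kappa>" "0 < \<epsilon>"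
    and small: "3 * v + \<sigma> / 2 \<le> \<kappa> / 16" "3 * v + \<sigma> / 2 \<le> \<epsilon> / 16"
    and "0 < (u - 1)\<^sup>2 - 1/8 - w"
  shows "- \<epsilon> * ((u - 1)\<^sup>2 - 1/8 - w) \<le> g"
proof -
  have \<kappa>w: "0 \<le> \<kappa> * w" and \<epsilon>\<phi>: "0 \<le> \<epsilon> * ((u - 1)\<^sup>2 - 1/8 - w)"
    using assms by simp_all
  have drift_ge: "- 3 * v \<le> (6 * u - 2 - 4 * \<theta>) * v"
    using assms by (intro mult_right_mono) auto
  consider (edge) "1/2 \<le> u" | (large) "1/16 \<le> w" | (centre) "u < 1/2" "w < 1/16"
    by linarith
  then show ?thesis
  proof cases
    case edge
    then have "1/2 * v \<le> (6 * u - 2 - 4 * \<theta>) * v"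
      using assms by (intro mult_right_mono) auto
    then show ?thesis
      using drift \<open>\<sigma> \<le> v\<close> \<kappa>w \<epsilon>\<phi> by linarith
  next
    case large
    then have "\<kappa> * (1/16) \<le> \<kappa> * w"
      using \<open>0 < \<kappa>\<close> by (intro mult_left_mono) auto
    then show ?thesis
      using drift drift_ge small(1) \<epsilon>\<phi> by linarith
  next
    case centre
    then have "(1/2)\<^sup>2 \<le> (1 - u)\<^sup>2"
      by (intro power_mono) auto
    then have "1/16 \<le> (u - 1)\<^sup>2 - 1/8 - w"
      using centre by (simp add: power2_commute[of 1 u] power_one_over)
    then have "\<epsilon> * (1/16) \<le> \<epsilon> * ((u - 1)\<^sup>2 - 1/8 - w)"
      using \<open>0 < \<epsilon>\<close> by (intro mult_left_mono) auto
    then show ?thesis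
      using drift drift_ge small(2) \<kappa>w by linarith
  qed
qed

lemma finite_bounded_states: "finite {x::'d::finite \<Rightarrow> nat. \<forall>a. real (x a) \<le> B}"
proof (rule finite_subset)
  show "{x::'d \<Rightarrow> nat. \<forall>a. real (x a) \<le> B} \<subseteq> PiE UNIV (\<lambda>_. {..nat \<lfloor>B\<rfloor>})"
    by (auto simp: le_nat_floor)
qed (auto intro: finite_PiE)

locale confined_martingale =
  fixes q :: "'d::finite option \<Rightarrow> 'd option \<Rightarrow> real" and c :: "'d \<Rightarrow> real" and i :: 'd
    and W :: "('d \<Rightarrow> nat) \<Rightarrow> real" and W0 C \<kappa> \<sigma> :: real
  assumes q_nonneg: "0 \<le> q k l"
    and c_nonneg: "0 \<le> c a" and c_le_1: "c a \<le> 1" and c_i: "c i = 1"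
    and martingale: "0 < x i \<Longrightarrow> gen q (lin c) x = 0"
    and \<sigma>_pos: "0 < \<sigma>" and \<sigma>_le_qvar: "0 < x i \<Longrightarrow> \<sigma> \<le> qvar q c x"
    and W_nonneg: "0 \<le> W x" and W_axis: "W ((\<lambda>_. 0)(i := n)) \<le> W0"
    and W_proper: "\<exists>Y. \<forall>x a. W x \<le> B \<longrightarrow> a \<noteq> i \<longrightarrow> real (x a) \<le> Y"
    and C_pos: "0 < C" and \<kappa>_pos: "0 < \<kappa>"
    and lyapunov: "0 < x i \<Longrightarrow> gen q W x \<le> C - \<kappa> * W x"
begin

definition coord :: "real \<Rightarrow> real \<Rightarrow> ('d \<Rightarrow> nat) \<Rightarrow> real" where
  "coord \<theta> r x = \<theta> * (lin c x - r)"

text \<open>The quartic \<open>(t\<^sup>2 - 1)\<^sup>2\<close> is convex near \<open>t = \<plusminus>1\<close>, which pays for the bounded positive drift of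
  \<open>\<delta> W\<close> there, and the offset \<open>1/8\<close> makes the function negative around \<open>t = \<plusminus>1\<close>, so that cutting it off
  there only helps.\<close>
definition bump :: "real \<Rightarrow> real \<Rightarrow> real \<Rightarrow> ('d \<Rightarrow> nat) \<Rightarrow> real" where
  "bump \<theta> \<delta> r x = ((coord \<theta> r x)\<^sup>2 - 1)\<^sup>2 - 1/8 - \<delta> * W x"

definition cut_bump :: "real \<Rightarrow> real \<Rightarrow> real \<Rightarrow> ('d \<Rightarrow> nat) \<Rightarrow> real" where
  "cut_bump \<theta> \<delta> r x = (if \<bar>coord \<theta> r x\<bar> < 1 then max 0 (bump \<theta> \<delta> r x) else 0)"

lemma cut_bump_nonneg: "0 \<le> cut_bump \<theta> \<delta> r x"
  by (simp add: cut_bump_def)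

lemma cut_bump_nonzeroD:
  assumes "cut_bump \<theta> \<delta> r x \<noteq> 0"
  shows "\<bar>coord \<theta> r x\<bar> < 1" "0 < bump \<theta> \<delta> r x" "cut_bump \<theta> \<delta> r x = bump \<theta> \<delta> r x" "\<delta> * W x \<le> 1"
proof -
  show near: "\<bar>coord \<theta> r x\<bar> < 1" and pos: "0 < bump \<theta> \<delta> r x" and "cut_bump \<theta> \<delta> r x = bump \<theta> \<delta> r x"
    using assms by (auto simp: cut_bump_def max_def split: if_splits)
  have "(coord \<theta> r x)\<^sup>2 \<le> 1"
    using near by (simp add: abs_square_le_1)
  then have "((coord \<theta> r x)\<^sup>2 - 1)\<^sup>2 \<le> 1"
    by (simp add: abs_square_le_1)
  then show "\<delta> * W x \<le> 1"
    using pos by (simp add: bump_def)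
qed

lemma increment_le_1: "\<bar>increment c k l\<bar> \<le> 1"
proof -
  have "0 \<le> case_option 0 c k \<and> case_option 0 c k \<le> 1" for k
    using c_nonneg c_le_1 by (cases k) auto
  from this[of k] this[of l] show ?thesis
    unfolding increment_def by linarith
qed

lemma coord_move: "enabled k x \<Longrightarrow> coord \<theta> r (move k l x) = coord \<theta> r x + \<theta> * increment c k l"
  by (simp add: coord_def lin_move algebra_simps)

lemma coord_step_le: "0 < \<theta> \<Longrightarrow> \<bar>\<theta> * increment c k l\<bar> \<le> \<theta>"
  using increment_le_1[of k l] by (simp add: abs_mult mult_left_le)

lemma lin_split: "lin c x = real (x i) + (\<Sum>a\<in>UNIV - {i}. c a * real (x a))"
  unfolding lin_def using c_i by (subst sum.remove[of _ i]) auto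

lemma lin_le_on_sublevel: "\<exists>Z. \<forall>x. W x \<le> B \<longrightarrow> lin c x \<le> real (x i) + Z"
proof -
  obtain Y where Y: "\<And>x a. W x \<le> B \<Longrightarrow> a \<noteq> i \<Longrightarrow> real (x a) \<le> Y"
    using W_proper by blast
  have "lin c x \<le> real (x i) + (\<Sum>a\<in>UNIV - {i}. Y)" if "W x \<le> B" for x
    unfolding lin_split
  proof (intro add_left_mono sum_mono)
    fix a assume "a \<in> UNIV - {i}"
    then show "c a * real (x a) \<le> Y"
      using Y[OF that, of a] mult_right_mono[OF c_le_1[of a], of "real (x a)"] by simp
  qed
  then show ?thesis
    by blast
qed

lemma finite_sublevel: "finite {x. W x \<le> B \<and> lin c x \<le> D}"
proof -
  obtain Y where Y: "\<And>x a. W x \<le> B \<Longrightarrow> a \<noteq> i \<Longrightarrow> real (x a) \<le> Y"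
    using W_proper by blast
  have "real (x a) \<le> max D Y" if "W x \<le> B" "lin c x \<le> D" for x a
  proof (cases "a = i")
    case True
    have "real (x i) \<le> lin c x"
      unfolding lin_split by (simp add: sum_nonneg c_nonneg)
    then show ?thesis
      using that True by simp
  qed (use Y[OF that(1)] in force)
  then show ?thesis
    by (intro finite_subset[OF _ finite_bounded_states[of "max D Y"]]) blast
qed

lemma cut_bump_support:
  assumes "0 < \<theta>" "0 < \<delta>" "cut_bump \<theta> \<delta> r x \<noteq> 0"
  shows "W x \<le> 1 / \<delta>" "lin c x \<le> r + 1 / \<theta>" "r - 1 / \<theta> \<le> lin c x"
  using cut_bump_nonzeroD[OF assms(3)] assms(1,2) by (auto simp: coord_def abs_less_iff field_simps)

lemma finite_cut_bump_support:
  assumes "0 < \<theta>" "0 < \<delta>"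
  shows "finite {x. cut_bump \<theta> \<delta> r x \<noteq> 0}"
  by (rule finite_subset[OF _ finite_sublevel[of "1 / \<delta>" "r + 1 / \<theta>"]])
    (use cut_bump_support[OF assms] in blast)

lemma cut_bump_support_far:
  assumes "0 < \<theta>" "0 < \<delta>"
  shows "\<exists>n. \<forall>x. cut_bump \<theta> \<delta> (real n) x \<noteq> 0 \<longrightarrow> N \<le> real (x i)"
proof -
  obtain Z where Z: "\<And>x. W x \<le> 1 / \<delta> \<Longrightarrow> lin c x \<le> real (x i) + Z"
    using lin_le_on_sublevel by blast
  obtain n where n: "N + Z + 1 / \<theta> \<le> real n"
    using real_arch_simple by blast
  have "N \<le> real (x i)" if "cut_bump \<theta> \<delta> (real n) x \<noteq> 0" for x
    using cut_bump_support[OF assms that] Z[of x] n by linarith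
  then show ?thesis
    by blast
qed

lemma cut_bump_centre_nonzero:
  assumes "0 < \<delta>" "\<delta> * W0 \<le> 1/2"
  shows "cut_bump \<theta> \<delta> (real n) ((\<lambda>_. 0)(i := n)) \<noteq> 0"
proof -
  have "coord \<theta> (real n) ((\<lambda>_. 0)(i := n)) = 0"
    by (simp add: coord_def lin_split)
  moreover have "\<delta> * W ((\<lambda>_. 0)(i := n)) \<le> 1/2"
    using mult_left_mono[OF W_axis[of n], of \<delta>] assms by linarith
  ultimately show ?thesis
    by (simp add: cut_bump_def bump_def)
qed

lemma gen_bump_ge:
  assumes "0 < \<theta>" "0 < \<delta>" "0 < x i" "\<bar>coord \<theta> r x\<bar> \<le> 1"
  shows "(6 * (coord \<theta> r x)\<^sup>2 - 2 - 4 * \<theta>) * (\<theta>\<^sup>2 * qvar q c x) - \<delta> * (C - \<kappa> * W x)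
    \<le> gen q (bump \<theta> \<delta> r) x"
proof -
  let ?t = "coord \<theta> r"
  have "(4 * ?t x ^ 3 - 4 * ?t x) * \<theta> * gen q (lin c) x + (6 * (?t x)\<^sup>2 - 2 - 4 * \<theta>) * \<theta>\<^sup>2 * qvar q c x
      \<le> gen q (\<lambda>x. ((?t x)\<^sup>2 - 1)\<^sup>2 - 1/8) x"
  proof (rule gen_ge_of_quadratic[OF q_nonneg])
    fix k l assume "enabled k x"
    then show "(4 * ?t x ^ 3 - 4 * ?t x) * \<theta> * increment c k l
        + (6 * (?t x)\<^sup>2 - 2 - 4 * \<theta>) * \<theta>\<^sup>2 * (increment c k l)\<^sup>2
        \<le> ((?t (move k l x))\<^sup>2 - 1)\<^sup>2 - 1/8 - (((?t x)\<^sup>2 - 1)\<^sup>2 - 1/8)"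
      using quartic_increment_ge[OF assms(4) coord_step_le[OF assms(1), of k l]]
      by (simp add: coord_move power_mult_distrib mult.assoc)
  qed
  moreover have "\<delta> * gen q W x \<le> \<delta> * (C - \<kappa> * W x)"
    using assms by (intro mult_left_mono lyapunov) auto
  moreover have "gen q (bump \<theta> \<delta> r) x = gen q (\<lambda>x. ((?t x)\<^sup>2 - 1)\<^sup>2 - 1/8) x - \<delta> * gen q W x"
    unfolding bump_def by (simp only: gen_diff gen_cmult)
  ultimately show ?thesis
    using martingale[of x] assms(3) by (simp add: mult.assoc)
qed

lemma gen_cut_bump_ge_gen_bump:
  assumes "0 < \<theta>" "\<theta> \<le> 1/8" "0 < \<delta>" "cut_bump \<theta> \<delta> r x \<noteq> 0"
  shows "gen q (bump \<theta> \<delta> r) x \<le> gen q (cut_bump \<theta> \<delta> r) x"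
  unfolding gen_def
proof (rule jump_sum_mono[OF q_nonneg])
  fix k l assume "enabled k x"
  then have "\<bar>coord \<theta> r (move k l x)\<bar> \<le> 9/8"
    using cut_bump_nonzeroD(1)[OF assms(4)] coord_step_le[OF assms(1), of k l] assms(2)
    unfolding coord_move[OF \<open>enabled k x\<close>] by linarith
  moreover have "0 \<le> \<delta> * W (move k l x)"
    using assms(3) W_nonneg by simp
  ultimately have "bump \<theta> \<delta> r (move k l x) \<le> cut_bump \<theta> \<delta> r (move k l x)"
    using quartic_outside_le[of "coord \<theta> r (move k l x)"]
    unfolding cut_bump_def by (auto simp: bump_def not_less)
  then show "bump \<theta> \<delta> r (move k l x) - bump \<theta> \<delta> r x \<le> cut_bump \<theta> \<delta> r (move k l x) - cut_bump \<theta> \<delta> r x"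
    using cut_bump_nonzeroD(3)[OF assms(4)] by simp
qed

lemma gen_cut_bump_ge:
  assumes \<theta>: "0 < \<theta>" "\<theta> \<le> 1/8" and \<delta>: "0 < \<delta>" "\<delta> * C = \<theta>\<^sup>2 * \<sigma> / 2" and "0 < \<epsilon>"
    and small: "3 * (\<theta>\<^sup>2 * total_rate q) + \<theta>\<^sup>2 * \<sigma> / 2 \<le> min \<kappa> \<epsilon> / 16"
    and x: "0 < x i" "cut_bump \<theta> \<delta> r x \<noteq> 0"
  shows "- \<epsilon> * cut_bump \<theta> \<delta> r x \<le> gen q (cut_bump \<theta> \<delta> r) x"
  unfolding cut_bump_nonzeroD(3)[OF x(2)] unfolding bump_def
proof (rule quartic_drift_ge[where v = "\<theta>\<^sup>2 * qvar q c x"])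
  have "\<delta> * (C - \<kappa> * W x) = \<delta> * C - \<kappa> * (\<delta> * W x)"
    by (simp add: algebra_simps)
  then show "(6 * (coord \<theta> r x)\<^sup>2 - 2 - 4 * \<theta>) * (\<theta>\<^sup>2 * qvar q c x) - \<theta>\<^sup>2 * \<sigma> / 2 + \<kappa> * (\<delta> * W x)
      \<le> gen q (cut_bump \<theta> \<delta> r) x"
    using gen_bump_ge[of \<theta> \<delta> x r] gen_cut_bump_ge_gen_bump[of \<theta> \<delta> r x] cut_bump_nonzeroD(1)[OF x(2)] \<theta> \<delta> x
    by linarith
  have "\<theta>\<^sup>2 * qvar q c x \<le> \<theta>\<^sup>2 * total_rate q"
    using qvar_le[where x = x, OF q_nonneg increment_le_1] by (intro mult_left_mono) simp_all
  then show "3 * (\<theta>\<^sup>2 * qvar q c x) + \<theta>\<^sup>2 * \<sigma> / 2 \<le> \<kappa> / 16" "3 * (\<theta>\<^sup>2 * qvar q c x) + \<theta>\<^sup>2 * \<sigma> / 2 \<le> \<epsilon> / 16"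
    using small by simp_all
  show "\<theta>\<^sup>2 * \<sigma> \<le> \<theta>\<^sup>2 * qvar q c x"
    using \<sigma>_le_qvar[of x] x(1) by (intro mult_left_mono) auto
  show "0 < ((coord \<theta> r x)\<^sup>2 - 1)\<^sup>2 - 1/8 - \<delta> * W x"
    using cut_bump_nonzeroD(2)[OF x(2)] by (simp add: bump_def)
qed (use assms W_nonneg \<sigma>_pos \<kappa>_pos in auto)

lemma small_parameters:
  assumes "0 < \<epsilon>"
  obtains \<theta> \<delta> where "0 < \<theta>" "\<theta> \<le> 1/8" "0 < \<delta>" "\<delta> * C = \<theta>\<^sup>2 * \<sigma> / 2" "\<delta> * W0 \<le> 1/2"
    "3 * (\<theta>\<^sup>2 * total_rate q) + \<theta>\<^sup>2 * \<sigma> / 2 \<le> min \<kappa> \<epsilon> / 16"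
proof -
  have "\<forall>\<^sub>F \<theta> in at_right 0. \<theta> < 1/8 \<and> \<theta>\<^sup>2 * \<sigma> / (2 * C) * W0 < 1/2
      \<and> 3 * (\<theta>\<^sup>2 * total_rate q) + \<theta>\<^sup>2 * \<sigma> / 2 < min \<kappa> \<epsilon> / 16 \<and> 0 < \<theta>"
    using assms C_pos \<kappa>_pos
    by (intro eventually_conj order_tendstoD(2)[where y=0] eventually_at_right_less)
      (auto intro!: tendsto_eq_intros)
  then obtain \<theta> where \<theta>: "\<theta> < 1/8" "\<theta>\<^sup>2 * \<sigma> / (2 * C) * W0 < 1/2"
      "3 * (\<theta>\<^sup>2 * total_rate q) + \<theta>\<^sup>2 * \<sigma> / 2 < min \<kappa> \<epsilon> / 16" "0 < \<theta>"
    using eventually_happens'[OF trivial_limit_at_right_real] by blast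
  then show thesis
    using that[of \<theta> "\<theta>\<^sup>2 * \<sigma> / (2 * C)"] \<sigma>_pos C_pos by auto
qed

lemma ex_test_function:
  assumes "0 < \<epsilon>"
  obtains \<psi> x0 where "finite {x. \<psi> x \<noteq> 0}" "\<And>x. 0 \<le> \<psi> x" "\<psi> x0 \<noteq> 0" "\<And>x. \<psi> x \<noteq> 0 \<Longrightarrow> N \<le> real (x i)"
    "\<And>x. 0 < x i \<Longrightarrow> \<psi> x \<noteq> 0 \<Longrightarrow> - \<epsilon> * \<psi> x \<le> gen q \<psi> x"
proof -
  obtain \<theta> \<delta> where \<theta>: "0 < \<theta>" "\<theta> \<le> 1/8" and \<delta>: "0 < \<delta>" "\<delta> * C = \<theta>\<^sup>2 * \<sigma> / 2" "\<delta> * W0 \<le> 1/2"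
    and small: "3 * (\<theta>\<^sup>2 * total_rate q) + \<theta>\<^sup>2 * \<sigma> / 2 \<le> min \<kappa> \<epsilon> / 16"
    using small_parameters[OF assms] .
  obtain n where "\<And>x. cut_bump \<theta> \<delta> (real n) x \<noteq> 0 \<Longrightarrow> N \<le> real (x i)"
    using cut_bump_support_far[OF \<theta>(1) \<delta>(1)] by blast
  then show thesis
    using that[of "cut_bump \<theta> \<delta> (real n)"] finite_cut_bump_support[OF \<theta>(1) \<delta>(1)] cut_bump_nonneg
      cut_bump_centre_nonzero[OF \<delta>(1,3)] gen_cut_bump_ge[OF \<theta> \<delta>(1,2) assms small]
    by blast
qed

end

section \<open>Exponential Lyapunov functions\<close>

lemma exp_le_quadratic:
  fixes x :: real
  assumes "x \<le> 1"
  shows "exp x \<le> 1 + x + x\<^sup>2"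
proof (cases "0 \<le> x")
  case True
  then show ?thesis
    using assms by (rule exp_bound)
next
  case False
  have "1 \<le> (1 + x + x\<^sup>2) * (1 - x)"
    using False by (simp add: algebra_simps power2_eq_square mult_nonpos_nonneg)
  also have "\<dots> \<le> (1 + x + x\<^sup>2) * exp (- x)"
  proof (rule mult_left_mono)
    show "1 - x \<le> exp (- x)"
      using exp_ge_add_one_self[of "- x"] by simp
    have "0 \<le> (1 + x / 2)\<^sup>2 + 3 / 4 * x\<^sup>2"
      by simp
    then show "0 \<le> 1 + x + x\<^sup>2"
      by (simp add: power2_eq_square algebra_simps)
  qed
  finally show ?thesis
    by (simp add: exp_minus field_simps)
qed

lemma exp_absorb_smaller_rate:
  fixes \<rho> A B :: real
  assumes "\<rho> < 1" "0 \<le> A" "0 < B"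
  obtains D where "0 < D" "\<And>s. 0 \<le> s \<Longrightarrow> A * exp (\<rho> * s) \<le> B * exp s + D"
proof -
  define s0 where "s0 = A / B / (1 - \<rho>)"
  have s0: "A = B * ((1 - \<rho>) * s0)"
    using assms by (simp add: s0_def)
  have "A * exp (\<rho> * s) \<le> B * exp s + (A * exp s0 + 1)" if "0 \<le> s" for s
  proof (cases "s \<le> s0")
    case True
    have "\<rho> * s \<le> s0"
      using True mult_right_mono[of \<rho> 1 s] assms(1) that by simp
    then have "A * exp (\<rho> * s) \<le> A * exp s0"
      using assms by (intro mult_left_mono) auto
    then show ?thesis
      using assms by (simp add: add_increasing)
  next
    case False
    have "(1 - \<rho>) * s0 \<le> (1 - \<rho>) * s"
      using False assms by (intro mult_left_mono) auto
    also have "\<dots> \<le> exp ((1 - \<rho>) * s)"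
      using exp_ge_add_one_self[of "(1 - \<rho>) * s"] by linarith
    finally have "A * exp (\<rho> * s) \<le> B * exp ((1 - \<rho>) * s) * exp (\<rho> * s)"
      unfolding s0 using assms by (intro mult_right_mono mult_left_mono) auto
    also have "\<dots> = B * exp s"
      by (simp add: mult.assoc exp_add[symmetric] algebra_simps)
    finally show ?thesis
      using assms by (simp add: add_increasing2)
  qed
  then show thesis
    using that[of "A * exp s0 + 1"] assms by (simp add: add_nonneg_pos)
qed

lemma gen_exp_lin_le:
  assumes q: "\<And>k l. 0 \<le> q k l" and w: "\<And>k l. \<bar>increment w k l\<bar> \<le> B" and a: "0 \<le> a" "a * B \<le> 1"
  shows "gen q (\<lambda>x. exp (a * lin w x)) x
    \<le> a * exp (a * lin w x) * (gen q (lin w) x + a * (B\<^sup>2 * total_rate q))"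
proof -
  let ?E = "exp (a * lin w x)"
  have "gen q (\<lambda>x. exp (a * lin w x)) x \<le> (a * ?E) * gen q (lin w) x + (a\<^sup>2 * ?E) * qvar q w x"
  proof (rule gen_le_of_quadratic[OF q])
    fix k l assume "enabled k x"
    have "a * increment w k l \<le> a * B"
      using w[of k l] a(1) by (intro mult_left_mono) auto
    then have "?E * exp (a * increment w k l) \<le> ?E * (1 + a * increment w k l + (a * increment w k l)\<^sup>2)"
      using a(2) by (intro mult_left_mono exp_le_quadratic) auto
    then show "exp (a * lin w (move k l x)) - ?E
        \<le> (a * ?E) * increment w k l + (a\<^sup>2 * ?E) * (increment w k l)\<^sup>2"
      unfolding lin_move[OF \<open>enabled k x\<close>] by (simp add: exp_add algebra_simps power_mult_distrib)
  qed
  also have "\<dots> \<le> (a * ?E) * gen q (lin w) x + (a\<^sup>2 * ?E) * (B\<^sup>2 * total_rate q)"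
    using q w by (intro add_left_mono mult_left_mono qvar_le) auto
  also have "\<dots> = a * ?E * (gen q (lin w) x + a * (B\<^sup>2 * total_rate q))"
    by (simp add: algebra_simps power2_eq_square)
  finally show ?thesis .
qed

lemma small_exponent:
  fixes q :: "'d::finite option \<Rightarrow> 'd option \<Rightarrow> real" and w :: "'j \<Rightarrow> 'd \<Rightarrow> real"
  assumes q: "\<And>k l. 0 \<le> q k l" and "finite J" "0 < \<eta>"
  obtains a where "0 < a" "\<And>j x. j \<in> J \<Longrightarrow>
    gen q (\<lambda>x. exp (a * lin (w j) x)) x \<le> a * exp (a * lin (w j) x) * (gen q (lin (w j)) x + \<eta>)"
proof -
  have "bdd_above ((\<lambda>(j, k). \<bar>w j k\<bar>) ` (J \<times> UNIV))"
    using \<open>finite J\<close> by (intro bdd_above_finite) auto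
  then obtain M where "\<And>j k. j \<in> J \<Longrightarrow> \<bar>w j k\<bar> \<le> M"
    by (force simp: bdd_above_def)
  then have incr: "\<bar>increment (w j) k l\<bar> \<le> 2 * M" if "j \<in> J" for j k l
    using that by (intro abs_increment_le) auto
  have "\<forall>\<^sub>F a in at_right 0. a * (2 * M) < 1 \<and> a * ((2 * M)\<^sup>2 * total_rate q) < \<eta> \<and> 0 < a"
    using \<open>0 < \<eta>\<close>
    by (intro eventually_conj order_tendstoD(2)[where y=0] eventually_at_right_less)
      (auto intro!: tendsto_eq_intros)
  then obtain a where a: "a * (2 * M) < 1" "a * ((2 * M)\<^sup>2 * total_rate q) < \<eta>" "0 < a"
    using eventually_happens'[OF trivial_limit_at_right_real] by blast
  have "gen q (\<lambda>x. exp (a * lin (w j) x)) x \<le> a * exp (a * lin (w j) x) * (gen q (lin (w j)) x + \<eta>)"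
    if "j \<in> J" for j x
  proof -
    have "gen q (\<lambda>x. exp (a * lin (w j) x)) x
        \<le> a * exp (a * lin (w j) x) * (gen q (lin (w j)) x + a * ((2 * M)\<^sup>2 * total_rate q))"
      using q incr[OF that] a by (intro gen_exp_lin_le) auto
    also have "\<dots> \<le> a * exp (a * lin (w j) x) * (gen q (lin (w j)) x + \<eta>)"
      using a by (intro mult_left_mono add_left_mono) auto
    finally show ?thesis .
  qed
  then show thesis
    using that a(3) by blast
qed

lemma ex_level_exp_le_sum:
  fixes f :: "'j \<Rightarrow> real"
  assumes "finite J"
  obtains \<tau> where "0 \<le> \<tau>" "\<And>j. j \<in> J \<Longrightarrow> f j \<le> \<tau>" "exp (a * \<tau>) \<le> 1 + (\<Sum>j\<in>J. exp (a * f j))"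
proof -
  define \<tau> where "\<tau> = Max (insert 0 (f ` J))"
  have upper: "0 \<le> \<tau>" "\<And>j. j \<in> J \<Longrightarrow> f j \<le> \<tau>"
    using assms by (simp_all add: \<tau>_def)
  have "\<tau> \<in> insert 0 (f ` J)"
    unfolding \<tau>_def using assms by (intro Max_in) auto
  then consider (zero) "\<tau> = 0" | (attained) j where "j \<in> J" "\<tau> = f j"
    by blast
  then have "exp (a * \<tau>) \<le> 1 + (\<Sum>j\<in>J. exp (a * f j))"
  proof cases
    case zero
    then show ?thesis
      by (simp add: sum_nonneg)
  next
    case attained
    then show ?thesis
      using member_le_sum[of j J "\<lambda>j. exp (a * f j)"] assms by simp
  qed
  then show thesis
    using that upper by blast
qed

lemma busy_or_small_drift_le:
  fixes a e e' g \<eta> C L :: real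
  assumes "L \<le> a * e * (g + \<eta>)" and "0 \<le> a" "0 \<le> e" "0 \<le> e'" "0 \<le> C" "0 \<le> \<eta>"
    and "g \<le> - (2 * \<eta>) \<or> g \<le> C \<and> e \<le> e'"
  shows "L \<le> a * ((C + 2 * \<eta>) * e' - \<eta> * e)"
proof -
  have "e * (g + \<eta>) \<le> (C + 2 * \<eta>) * e' - \<eta> * e"
    using assms(7)
  proof (elim disjE conjE)
    assume "g \<le> - (2 * \<eta>)"
    then have "e * (g + \<eta>) \<le> e * (- \<eta>)"
      using assms(3) by (intro mult_left_mono) auto
    moreover have "0 \<le> (C + 2 * \<eta>) * e'"
      using assms(4-6) by simp
    ultimately show ?thesis
      by (simp add: mult.commute)
  next
    assume "g \<le> C" "e \<le> e'"
    then have "e * (g + \<eta>) \<le> e * (C + \<eta>)"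
      using assms(3) by (intro mult_left_mono) auto
    also have "\<dots> = (C + 2 * \<eta>) * e - \<eta> * e"
      by (simp add: algebra_simps)
    also have "\<dots> \<le> (C + 2 * \<eta>) * e' - \<eta> * e"
      using \<open>e \<le> e'\<close> assms(5,6) by (intro diff_right_mono mult_left_mono) auto
    finally show ?thesis .
  qed
  then have "a * (e * (g + \<eta>)) \<le> a * ((C + 2 * \<eta>) * e' - \<eta> * e)"
    using assms(2) by (rule mult_left_mono)
  then show ?thesis
    using assms(1) by (simp add: mult.assoc)
qed

text \<open>A queue \<open>j\<close> without downward drift is dominated by the largest of the linear functions, so that its
  exponential is of smaller order than the whole sum.\<close>
lemma exp_lyapunov:
  fixes q :: "'d::finite option \<Rightarrow> 'd option \<Rightarrow> real" and w :: "'j \<Rightarrow> 'd \<Rightarrow> real"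
  assumes q: "\<And>k l. 0 \<le> q k l" and "finite J" "0 < \<eta>" "\<rho> < 1" "0 \<le> C"
    and dichotomy: "\<And>x j. x \<in> S \<Longrightarrow> j \<in> J \<Longrightarrow> gen q (lin (w j)) x \<le> - (2 * \<eta>)
       \<or> gen q (lin (w j)) x \<le> C \<and> (\<forall>\<tau>\<ge>0. (\<forall>k\<in>J. lin (w k) x \<le> \<tau>) \<longrightarrow> lin (w j) x \<le> \<rho> * \<tau>)"
  obtains a D \<kappa> where "0 < a" "0 < D" "0 < \<kappa>"
    "\<And>x. x \<in> S \<Longrightarrow> gen q (\<lambda>x. \<Sum>j\<in>J. exp (a * lin (w j) x)) x \<le> D - \<kappa> * (\<Sum>j\<in>J. exp (a * lin (w j) x))"
proof -
  obtain a where a: "0 < a" and gen_exp: "\<And>j x. j \<in> J \<Longrightarrow>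
      gen q (\<lambda>x. exp (a * lin (w j) x)) x \<le> a * exp (a * lin (w j) x) * (gen q (lin (w j)) x + \<eta>)"
    by (rule small_exponent[where q = q and w = w, OF q \<open>finite J\<close> \<open>0 < \<eta>\<close>]) (rule that)
  let ?A = "real (card J) * (C + 2 * \<eta>)"
  obtain D where D: "0 < D" "\<And>s. 0 \<le> s \<Longrightarrow> ?A * exp (\<rho> * s) \<le> \<eta> / 2 * exp s + D"
    by (rule exp_absorb_smaller_rate[of \<rho> ?A "\<eta> / 2"]) (use assms(3-5) in auto)
  have "gen q (\<lambda>x. \<Sum>j\<in>J. exp (a * lin (w j) x)) x
      \<le> a * (\<eta> / 2 + D) - a * \<eta> / 2 * (\<Sum>j\<in>J. exp (a * lin (w j) x))" if "x \<in> S" for x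
  proof -
    let ?E = "\<lambda>j. exp (a * lin (w j) x)"
    obtain \<tau> where \<tau>: "0 \<le> \<tau>" "\<And>j. j \<in> J \<Longrightarrow> lin (w j) x \<le> \<tau>" "exp (a * \<tau>) \<le> 1 + (\<Sum>j\<in>J. ?E j)"
      by (rule ex_level_exp_le_sum[where f = "\<lambda>j. lin (w j) x" and a = a, OF \<open>finite J\<close>]) (rule that)
    have gen_exp_le: "gen q (\<lambda>x. exp (a * lin (w j) x)) x
        \<le> a * ((C + 2 * \<eta>) * exp (\<rho> * (a * \<tau>)) - \<eta> * ?E j)"
      if "j \<in> J" for j
    proof (rule busy_or_small_drift_le[OF gen_exp[OF that]])
      have "?E j \<le> exp (\<rho> * (a * \<tau>))" if "lin (w j) x \<le> \<rho> * \<tau>"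
        using mult_left_mono[OF that, of a] a by (simp add: mult.left_commute)
      then show "gen q (lin (w j)) x \<le> - (2 * \<eta>) \<or> gen q (lin (w j)) x \<le> C \<and> ?E j \<le> exp (\<rho> * (a * \<tau>))"
        using dichotomy[OF \<open>x \<in> S\<close> that] \<tau>(1,2) by blast
    qed (use a assms(3,5) in auto)
    have "gen q (\<lambda>x. \<Sum>j\<in>J. exp (a * lin (w j) x)) x
        \<le> (\<Sum>j\<in>J. a * ((C + 2 * \<eta>) * exp (\<rho> * (a * \<tau>)) - \<eta> * ?E j))"
      unfolding gen_sum by (intro sum_mono gen_exp_le)
    also have "\<dots> = a * (?A * exp (\<rho> * (a * \<tau>)) - \<eta> * (\<Sum>j\<in>J. ?E j))"
      by (simp add: sum_subtractf mult.assoc flip: sum_distrib_left)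
    also have "\<dots> \<le> a * (\<eta> / 2 * exp (a * \<tau>) + D - \<eta> * (\<Sum>j\<in>J. ?E j))"
      using a \<tau>(1) by (intro mult_left_mono diff_right_mono D) auto
    also have "\<dots> \<le> a * (\<eta> / 2 * (1 + (\<Sum>j\<in>J. ?E j)) + D - \<eta> * (\<Sum>j\<in>J. ?E j))"
      using a \<tau>(3) assms(3) by (intro mult_left_mono diff_right_mono add_right_mono) auto
    finally show ?thesis
      by (simp add: field_simps)
  qed
  then show thesis
    using that[of a "a * (\<eta> / 2 + D)" "a * \<eta> / 2"] a D(1) assms(3) by simp
qed

section \<open>Green functions of transient substochastic matrices\<close>

locale transient_matrix =
  fixes P :: "real^'d::finite^'d"
  assumes entry_nonneg: "0 \<le> P$k$l"
    and row_sum_le_1: "(\<Sum>l\<in>UNIV. P$k$l) \<le> 1"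
    and escape: "C \<noteq> {} \<Longrightarrow> \<exists>k\<in>C. (\<Sum>l\<in>UNIV. P$k$l) < 1 \<or> (\<exists>l. l \<notin> C \<and> 0 < P$k$l)"
begin

lemma min_principle:
  assumes super: "\<And>k. 0 \<le> g k \<or> (\<Sum>l\<in>UNIV. P$k$l * g l) \<le> g k"
  shows "0 \<le> g k"
proof (rule ccontr)
  assume "\<not> 0 \<le> g k"
  define m where "m = Min (range g)"
  have m_le: "m \<le> g l" for l
    by (simp add: m_def)
  have "m < 0"
    using m_le[of k] \<open>\<not> 0 \<le> g k\<close> by simp
  have "m \<in> range g"
    unfolding m_def by (intro Min_in) auto
  then obtain k where "g k = m" and k: "(\<Sum>l\<in>UNIV. P$k$l) < 1 \<or> (\<exists>l. g l \<noteq> m \<and> 0 < P$k$l)"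
    using escape[of "{k. g k = m}"] by auto
  have "(\<Sum>l\<in>UNIV. P$k$l * (g l - m)) = (\<Sum>l\<in>UNIV. P$k$l * g l) - (\<Sum>l\<in>UNIV. P$k$l) * m"
    by (simp add: right_diff_distrib sum_subtractf sum_distrib_right)
  also have "\<dots> \<le> (1 - (\<Sum>l\<in>UNIV. P$k$l)) * m"
    using super[of k] \<open>g k = m\<close> \<open>m < 0\<close> by (auto simp: left_diff_distrib)
  finally have upper: "(\<Sum>l\<in>UNIV. P$k$l * (g l - m)) \<le> (1 - (\<Sum>l\<in>UNIV. P$k$l)) * m" .
  have terms_nonneg: "0 \<le> P$k$l * (g l - m)" for l
    using entry_nonneg m_le by simp
  have lower: "0 \<le> (\<Sum>l\<in>UNIV. P$k$l * (g l - m))"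
    by (intro sum_nonneg terms_nonneg)
  have "0 \<le> (1 - (\<Sum>l\<in>UNIV. P$k$l)) * m"
    using lower upper by (rule order_trans)
  then have row: "(\<Sum>l\<in>UNIV. P$k$l) = 1"
    using row_sum_le_1[of k] \<open>m < 0\<close> by (simp add: zero_le_mult_iff)
  then have "(\<Sum>l\<in>UNIV. P$k$l * (g l - m)) = 0"
    using upper lower by simp
  then have "P$k$l = 0 \<or> g l = m" for l
    using terms_nonneg by (simp add: sum_nonneg_eq_0_iff)
  then show False
    using k row by (metis less_irrefl)
qed

lemma fixed_point_eq_0:
  assumes "\<And>k. g k = (\<Sum>l\<in>UNIV. P$k$l * g l)"
  shows "g k = 0"
proof (rule antisym)
  show "0 \<le> g k"
    by (rule min_principle) (simp flip: assms)
  have "0 \<le> - g k"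
    by (rule min_principle) (simp add: sum_negf flip: assms)
  then show "g k \<le> 0"
    by simp
qed

definition green :: "'d \<Rightarrow> 'd \<Rightarrow> real" where
  "green k j = matrix_inv (mat 1 - P) $ k $ j"

lemma matrix_inv_mat_1_minus:
  "(mat 1 - P) ** matrix_inv (mat 1 - P) = mat 1" "matrix_inv (mat 1 - P) ** (mat 1 - P) = mat 1"
proof -
  have "v = 0" if "(mat 1 - P) *v v = 0" for v :: "real^'d"
  proof -
    have "v = P *v v"
      using that by (simp add: matrix_vector_mult_diff_rdistrib)
    then have "v $ k = (P *v v) $ k" for k
      by (rule arg_cong)
    then have "v $ k = (\<Sum>l\<in>UNIV. P$k$l * v$l)" for k
      unfolding matrix_vector_mult_def vec_lambda_beta .
    then have "v $ k = 0" for k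
      by (rule fixed_point_eq_0)
    then show ?thesis
      by (simp add: vec_eq_iff)
  qed
  then have "invertible (mat 1 - P)"
    by (simp add: invertible_left_inverse matrix_left_invertible_ker)
  then have "\<exists>A. (mat 1 - P) ** A = mat 1 \<and> A ** (mat 1 - P) = mat 1"
    by (simp add: invertible_def)
  from someI_ex[OF this] show "(mat 1 - P) ** matrix_inv (mat 1 - P) = mat 1"
    "matrix_inv (mat 1 - P) ** (mat 1 - P) = mat 1"
    by (simp_all add: matrix_inv_def)
qed

lemma green_right: "green k j = of_bool (k = j) + (\<Sum>l\<in>UNIV. P$k$l * green l j)"
proof -
  have "((mat 1 - P) ** matrix_inv (mat 1 - P)) $ k $ j
      = (\<Sum>l\<in>UNIV. of_bool (k = l) * green l j - P$k$l * green l j)"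
    by (simp add: matrix_matrix_mult_def green_def mat_def of_bool_def left_diff_distrib)
  then show ?thesis
    unfolding matrix_inv_mat_1_minus by (cases "k = j") (simp_all add: sum_subtractf mat_def)
qed

lemma green_left: "green k j = of_bool (k = j) + (\<Sum>l\<in>UNIV. green k l * P$l$j)"
proof -
  have "(matrix_inv (mat 1 - P) ** (mat 1 - P)) $ k $ j
      = (\<Sum>l\<in>UNIV. green k l * of_bool (l = j) - green k l * P$l$j)"
    by (simp add: matrix_matrix_mult_def green_def mat_def of_bool_def right_diff_distrib)
  then show ?thesis
    unfolding matrix_inv_mat_1_minus by (cases "k = j") (simp_all add: sum_subtractf mat_def)
qed

lemma green_unique:
  assumes "\<And>k. g k = of_bool (k = j) + (\<Sum>l\<in>UNIV. P$k$l * g l)"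
  shows "g k = green k j"
proof -
  have "g k - green k j = (\<Sum>l\<in>UNIV. P$k$l * (g l - green l j))" for k
    using assms[of k] green_right[of k j] by (simp add: right_diff_distrib sum_subtractf)
  then have "g k - green k j = 0"
    by (rule fixed_point_eq_0)
  then show ?thesis
    by simp
qed

lemma green_nonneg: "0 \<le> green k j"
proof (rule min_principle[where g = "\<lambda>k. green k j"])
  show "0 \<le> green k j \<or> (\<Sum>l\<in>UNIV. P$k$l * green l j) \<le> green k j" for k
    using green_right[of k j] by simp
qed

lemma green_diag_pos: "0 < green j j"
proof -
  have "0 \<le> (\<Sum>l\<in>UNIV. P$j$l * green l j)"
    by (intro sum_nonneg mult_nonneg_nonneg green_nonneg entry_nonneg)
  then show ?thesis
    using green_right[of j j] by simp
qed

lemma green_le_diag: "green k j \<le> green j j"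
proof -
  have "0 \<le> green j j - green k j"
  proof (rule min_principle[where g = "\<lambda>k. green j j - green k j"])
    fix k
    have "(\<Sum>l\<in>UNIV. P$k$l * (green j j - green l j))
        = (\<Sum>l\<in>UNIV. P$k$l) * green j j - (\<Sum>l\<in>UNIV. P$k$l * green l j)"
      by (simp add: right_diff_distrib sum_subtractf sum_distrib_right)
    moreover have "(\<Sum>l\<in>UNIV. P$k$l) * green j j \<le> green j j"
      using mult_right_mono[OF row_sum_le_1 green_nonneg] by simp
    ultimately show "0 \<le> green j j - green k j
        \<or> (\<Sum>l\<in>UNIV. P$k$l * (green j j - green l j)) \<le> green j j - green k j"
      using green_right[of k j] by (cases "k = j") auto
  qed
  then show ?thesis
    by simp
qed

lemma inflow_eq_sum_green:
  assumes "\<And>m. nu m = lam m + (\<Sum>k\<in>UNIV. nu k * P$k$m)"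
  shows "nu j = (\<Sum>m\<in>UNIV. lam m * green m j)"
proof -
  have "(\<Sum>m\<in>UNIV. nu m * green m j)
      = (\<Sum>m\<in>UNIV. lam m * green m j) + (\<Sum>m\<in>UNIV. \<Sum>k\<in>UNIV. nu k * P$k$m * green m j)"
    by (subst assms) (simp add: distrib_right sum.distrib sum_distrib_right)
  moreover have "(\<Sum>m\<in>UNIV. \<Sum>k\<in>UNIV. nu k * P$k$m * green m j)
      = (\<Sum>k\<in>UNIV. nu k * (\<Sum>m\<in>UNIV. P$k$m * green m j))"
    by (subst sum.swap) (simp add: sum_distrib_left mult.assoc)
  moreover have "(\<Sum>k\<in>UNIV. nu k * green k j) = nu j + (\<Sum>k\<in>UNIV. nu k * (\<Sum>m\<in>UNIV. P$k$m * green m j))"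
    by (subst green_right) (simp add: distrib_left sum.distrib)
  ultimately show ?thesis
    by simp
qed

text \<open>\<open>hit i k\<close> is the probability that the chain started at \<open>k\<close> ever visits \<open>i\<close>; \<open>green_killed i k j\<close> is
  the expected number of its visits to \<open>j\<close> before \<open>i\<close>.\<close>
definition hit :: "'d \<Rightarrow> 'd \<Rightarrow> real" where
  "hit i k = green k i / green i i"

definition green_killed :: "'d \<Rightarrow> 'd \<Rightarrow> 'd \<Rightarrow> real" where
  "green_killed i k j = green k j - hit i k * green i j"

lemma hit_self [simp]: "hit i i = 1"
  using green_diag_pos[of i] by (simp add: hit_def)

lemma hit_nonneg: "0 \<le> hit i k"
  by (simp add: hit_def green_nonneg)

lemma hit_le_1: "hit i k \<le> 1"
  using green_diag_pos[of i] green_le_diag[of k i] by (simp add: hit_def)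

lemma hit_harmonic: "(\<Sum>l\<in>UNIV. P$k$l * hit i l) = hit i k - of_bool (k = i) / green i i"
proof -
  have "(\<Sum>l\<in>UNIV. P$k$l * hit i l) = (\<Sum>l\<in>UNIV. P$k$l * green l i) / green i i"
    by (simp add: hit_def sum_divide_distrib)
  then show ?thesis
    using green_right[of k i] by (simp add: hit_def add_divide_distrib)
qed

lemma green_killed_source [simp]: "green_killed i i j = 0"
  by (simp add: green_killed_def)

lemma green_killed_target [simp]: "green_killed i k i = 0"
  using green_diag_pos[of i] by (simp add: green_killed_def hit_def)

lemma green_killed_right:
  "(\<Sum>l\<in>UNIV. P$k$l * green_killed i l j)
    = green_killed i k j - of_bool (k = j) + of_bool (k = i) * green i j / green i i"
proof -
  have "(\<Sum>l\<in>UNIV. P$k$l * green_killed i l j)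
      = (\<Sum>l\<in>UNIV. P$k$l * green l j) - (\<Sum>l\<in>UNIV. P$k$l * hit i l) * green i j"
    by (simp add: green_killed_def right_diff_distrib sum_subtractf sum_distrib_right mult.assoc)
  then show ?thesis
    using green_right[of k j] unfolding hit_harmonic by (simp add: green_killed_def left_diff_distrib)
qed

lemma green_killed_left:
  assumes "j \<noteq> i"
  shows "(\<Sum>l\<in>UNIV. green_killed i k l * P$l$j) = green_killed i k j - of_bool (k = j)"
proof -
  have "(\<Sum>l\<in>UNIV. green_killed i k l * P$l$j)
      = (\<Sum>l\<in>UNIV. green k l * P$l$j) - hit i k * (\<Sum>l\<in>UNIV. green i l * P$l$j)"
    by (simp add: green_killed_def left_diff_distrib sum_subtractf sum_distrib_left mult.assoc)
  then show ?thesis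
    using green_left[of k j] green_left[of i j] assms by (simp add: green_killed_def)
qed

lemma green_killed_nonneg: "0 \<le> green_killed i k j"
proof (rule min_principle[where g = "\<lambda>k. green_killed i k j"])
  show "0 \<le> green_killed i k j \<or> (\<Sum>l\<in>UNIV. P$k$l * green_killed i l j) \<le> green_killed i k j" for k
    unfolding green_killed_right by (cases "k = i") simp_all
qed

lemma green_mult_green_less:
  assumes "i \<noteq> j"
  shows "green i j * green j i < green i i * green j j"
proof -
  have "0 \<le> (\<Sum>l\<in>UNIV. P$j$l * green_killed i l j)"
    by (intro sum_nonneg mult_nonneg_nonneg entry_nonneg green_killed_nonneg)
  then have "0 < green_killed i j j"
    using assms unfolding green_killed_right by simp
  then show ?thesis
    using green_diag_pos[of i] by (simp add: green_killed_def hit_def field_simps)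
qed

definition killed_flow :: "'d \<Rightarrow> ('d \<Rightarrow> real) \<Rightarrow> 'd \<Rightarrow> real" where
  "killed_flow i a j = (\<Sum>m\<in>UNIV. a m * green_killed i m j)"

lemma killed_flow_self [simp]: "killed_flow i a i = 0"
  by (simp add: killed_flow_def)

lemma killed_flow_nonneg: "(\<And>m. 0 \<le> a m) \<Longrightarrow> 0 \<le> killed_flow i a j"
  by (simp add: killed_flow_def sum_nonneg green_killed_nonneg)

lemma killed_flow_rec:
  assumes "j \<noteq> i"
  shows "killed_flow i a j = a j + (\<Sum>l\<in>UNIV. killed_flow i a l * P$l$j)"
proof -
  have "(\<Sum>l\<in>UNIV. killed_flow i a l * P$l$j) = (\<Sum>m\<in>UNIV. a m * (\<Sum>l\<in>UNIV. green_killed i m l * P$l$j))"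
    unfolding killed_flow_def sum_distrib_right sum_distrib_left mult.assoc by (rule sum.swap)
  also have "\<dots> = killed_flow i a j - a j"
    unfolding green_killed_left[OF assms] by (simp add: killed_flow_def right_diff_distrib sum_subtractf)
  finally show ?thesis
    by simp
qed

lemma killed_flow_ge:
  assumes "\<And>m. 0 \<le> a m" "j \<noteq> i"
  shows "a j \<le> killed_flow i a j"
  unfolding killed_flow_rec[OF assms(2)]
  using assms(1) by (simp add: sum_nonneg killed_flow_nonneg entry_nonneg)

lemma killed_flow_le_of_no_source:
  assumes "j \<noteq> i" "a j = 0" "\<And>k. k \<noteq> i \<Longrightarrow> killed_flow i a k \<le> \<tau> * killed_flow i (\<lambda>_. 1) k"
  shows "killed_flow i a j \<le> \<tau> * (killed_flow i (\<lambda>_. 1) j - 1)"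
proof -
  have "killed_flow i a k \<le> \<tau> * killed_flow i (\<lambda>_. 1) k" for k
    using assms(3)[of k] by (cases "k = i") simp_all
  then have "(\<Sum>k\<in>UNIV. killed_flow i a k * P$k$j) \<le> (\<Sum>k\<in>UNIV. \<tau> * killed_flow i (\<lambda>_. 1) k * P$k$j)"
    by (intro sum_mono mult_right_mono entry_nonneg)
  also have "\<dots> = \<tau> * (killed_flow i (\<lambda>_. 1) j - 1)"
    using killed_flow_rec[OF assms(1), of "\<lambda>_. 1"] by (simp add: sum_distrib_left mult.assoc)
  finally show ?thesis
    using killed_flow_rec[OF assms(1), of a] assms(2) by simp
qed

lemma killed_flow_of_inflow:
  assumes "\<And>m. nu m = lam m + (\<Sum>k\<in>UNIV. nu k * P$k$m)"
  shows "killed_flow i lam j = nu j - nu i * (green i j / green i i)"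
proof -
  have "killed_flow i lam j = (\<Sum>m\<in>UNIV. lam m * green m j)
      - (\<Sum>m\<in>UNIV. lam m * green m i) * (green i j / green i i)"
    by (simp add: killed_flow_def green_killed_def hit_def right_diff_distrib sum_subtractf
        sum_distrib_right sum_divide_distrib mult.assoc)
  then show ?thesis
    by (simp only: inflow_eq_sum_green[OF assms])
qed

end

section \<open>Irreducible networks\<close>

definition displacement :: "'d option \<Rightarrow> 'd option \<Rightarrow> 'd \<Rightarrow> int" where
  "displacement k l = (\<lambda>a. case_option 0 (\<lambda>i. unitv i a) l - case_option 0 (\<lambda>i. unitv i a) k)"

lemma sum_mult_displacement:
  fixes v :: "'d::finite \<Rightarrow> real"
  shows "(\<Sum>a\<in>UNIV. v a * of_int (displacement k l a)) = increment v k l"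
proof -
  have "(\<Sum>a\<in>UNIV. v a * of_int (case_option 0 (\<lambda>i. unitv i a) k)) = case_option 0 v k" for k
    by (cases k) (simp_all add: unitv_def if_distrib[of of_int] if_distrib[of "(*) _"] cong: if_cong)
  then show ?thesis
    by (simp add: displacement_def increment_def right_diff_distrib sum_subtractf)
qed

context jackson_parameters
begin

lemma jump_kernel_posD:
  assumes "0 < jump_kernel lam mu P z"
  shows "\<exists>k l. 0 < rate k l \<and> z = displacement k l"
proof (rule ccontr)
  assume "\<nexists>k l. 0 < rate k l \<and> z = displacement k l"
  then have rate_0: "rate k l = 0" if "z = displacement k l" for k l
    using that rate_nonneg[of k l] by (metis order_less_le)
  have "(if z = unitv i then lam i else 0) = 0"
    "(if z = (\<lambda>k. - unitv i k) then mu i * p0 P i else 0) = 0"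
    "(if j \<noteq> i \<and> z = (\<lambda>k. unitv j k - unitv i k) then mu i * P$i$j else 0) = 0" for i j
    using rate_0[of None "Some i"] rate_0[of "Some i" None] rate_0[of "Some i" "Some j"]
    by (simp_all add: displacement_def)
  then have "jump_kernel lam mu P z = 0"
    unfolding jump_kernel_def by (simp only: sum.neutral_const add_0)
  then show False
    using assms by simp
qed

lemma irreducible_imp_decreasing_move:
  assumes "jackson_irreducible lam mu P" "v a \<noteq> 0"
  shows "\<exists>k l. 0 < rate k l \<and> increment v k l < 0"
proof (rule ccontr)
  assume "\<nexists>k l. 0 < rate k l \<and> increment v k l < 0"
  then have jump: "0 \<le> (\<Sum>a\<in>UNIV. v a * of_int (z a))" if "0 < jump_kernel lam mu P z" for z
    using jump_kernel_posD[OF that] sum_mult_displacement[of v] by (metis not_less)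
  define y where "y = (\<lambda>b. (if 0 < v a then -1 else 1) * unitv a b)"
  have "((\<lambda>_. 0), y) \<in> {(u, u'). jump_kernel lam mu P (\<lambda>k. u' k - u k) > 0}\<^sup>*"
    using assms(1) unfolding jackson_irreducible_def by blast
  then have "0 \<le> (\<Sum>b\<in>UNIV. v b * of_int (y b))"
  proof (induction rule: rtrancl_induct)
    case (step u u')
    then show ?case
      using jump[of "\<lambda>k. u' k - u k"] by (simp add: right_diff_distrib sum_subtractf)
  qed simp
  also have "\<dots> = - \<bar>v a\<bar>"
    by (simp add: y_def unitv_def if_distrib[of of_int] if_distrib[of "(*) _"] cong: if_cong)
  finally show False
    using assms(2) by simp
qed

end

locale jackson_network = jackson_parameters lam mu P
  for lam mu :: "'d::finite \<Rightarrow> real" and P :: "real^'d^'d" +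
  fixes nu :: "'d \<Rightarrow> real"
  assumes irreducible: "jackson_irreducible lam mu P"
    and traffic: "nu j = lam j + (\<Sum>i\<in>UNIV. nu i * P$i$j)"
    and stable: "nu i < mu i"
begin

sublocale transient_matrix P
proof
  fix C :: "'d set"
  assume "C \<noteq> {}"
  then obtain a where "a \<in> C"
    by blast
  then obtain k l where "0 < rate k l" "increment (\<lambda>a. of_bool (a \<in> C)) k l < 0"
    using irreducible_imp_decreasing_move[OF irreducible, of "\<lambda>a. of_bool (a \<in> C)" a] by auto
  then show "\<exists>k\<in>C. (\<Sum>l\<in>UNIV. P$k$l) < 1 \<or> (\<exists>l. l \<notin> C \<and> 0 < P$k$l)"
    by (cases k; cases l)
      (auto simp: increment_def p0_def of_bool_def zero_less_mult_iff mu_pos[THEN less_not_sym]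
        split: if_splits)
qed (rule P_nonneg P_substoch)+

lemma ex_inflow:
  assumes "C \<noteq> {}"
  shows "\<exists>k\<in>C. 0 < lam k \<or> (\<exists>l. l \<notin> C \<and> 0 < P$l$k)"
proof -
  obtain a where "a \<in> C"
    using assms by blast
  then obtain k l where "0 < rate k l" "increment (\<lambda>a. - of_bool (a \<in> C)) k l < 0"
    using irreducible_imp_decreasing_move[OF irreducible, of "\<lambda>a. - of_bool (a \<in> C)" a] by auto
  then show ?thesis
    by (cases k; cases l)
      (auto simp: increment_def of_bool_def zero_less_mult_iff mu_pos[THEN less_not_sym]
        split: if_splits)
qed

lemma nu_eq_sum_green: "nu j = (\<Sum>m\<in>UNIV. lam m * green m j)"
  using traffic by (rule inflow_eq_sum_green)

lemma nu_pos: "0 < nu m"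
proof (rule ccontr)
  have nu_nonneg: "0 \<le> nu m" for m
    unfolding nu_eq_sum_green by (intro sum_nonneg mult_nonneg_nonneg lam_nonneg green_nonneg)
  assume "\<not> 0 < nu m"
  then obtain k where "nu k = 0" and k: "0 < lam k \<or> (\<exists>l. nu l \<noteq> 0 \<and> 0 < P$l$k)"
    using ex_inflow[of "{m. nu m = 0}"] nu_nonneg[of m] by auto
  have inflow_nonneg: "0 \<le> nu l * P$l$k" for l
    using nu_nonneg P_nonneg by simp
  then have "0 \<le> (\<Sum>l\<in>UNIV. nu l * P$l$k)"
    by (intro sum_nonneg)
  then have "lam k = 0" "(\<Sum>l\<in>UNIV. nu l * P$l$k) = 0"
    using traffic[of k] \<open>nu k = 0\<close> lam_nonneg[of k] by simp_all
  then show False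
    using k inflow_nonneg by (auto simp: sum_nonneg_eq_0_iff)
qed

text \<open>The bound \<open>G\<^sub>j\<^sub>i \<le> G\<^sub>i\<^sub>i\<close> for the time-reversed routing matrix.\<close>
lemma nu_mult_green_le: "nu i * green i j \<le> nu j * green i i"
proof -
  have nu_nonzero: "nu k \<noteq> 0" for k
    using nu_pos[of k] by simp
  define R :: "real^'d^'d" where "R = (\<chi> k l. nu l * P$l$k / nu k)"
  have row_sum: "(\<Sum>l\<in>UNIV. R$k$l) = 1 - lam k / nu k" for k
    using traffic[of k] nu_nonzero[of k] by (simp add: R_def field_simps flip: sum_divide_distrib)
  interpret reversed: transient_matrix R
  proof
    show "0 \<le> R$k$l" for k l
      using nu_pos P_nonneg by (simp add: R_def less_imp_le)
    show "(\<Sum>l\<in>UNIV. R$k$l) \<le> 1" for k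
      using nu_pos[of k] lam_nonneg[of k] by (simp add: row_sum)
    show "\<exists>k\<in>C. (\<Sum>l\<in>UNIV. R$k$l) < 1 \<or> (\<exists>l. l \<notin> C \<and> 0 < R$k$l)" if C: "C \<noteq> {}" for C
    proof -
      obtain k where "k \<in> C" and k: "0 < lam k \<or> (\<exists>l. l \<notin> C \<and> 0 < P$l$k)"
        using ex_inflow[OF C] by blast
      from k have "(\<Sum>l\<in>UNIV. R$k$l) < 1 \<or> (\<exists>l. l \<notin> C \<and> 0 < R$k$l)"
        unfolding row_sum using nu_pos by (auto simp: R_def)
      then show ?thesis
        using \<open>k \<in> C\<close> by blast
    qed
  qed
  have "reversed.green k i = nu i * green i k / nu k" for k
  proof (rule reversed.green_unique[symmetric])
    fix k
    have "(\<Sum>l\<in>UNIV. R$k$l * (nu i * green i l / nu l)) = nu i * (\<Sum>l\<in>UNIV. green i l * P$l$k) / nu k"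
      using nu_nonzero by (simp add: R_def sum_distrib_left sum_divide_distrib mult_ac)
    then show "nu i * green i k / nu k = of_bool (k = i) + (\<Sum>l\<in>UNIV. R$k$l * (nu i * green i l / nu l))"
      using green_left[of i k] nu_nonzero[of i] by (simp add: field_simps)
  qed
  then show ?thesis
    using reversed.green_le_diag[of j i] nu_pos[of j] nu_nonzero[of i] by (simp add: field_simps)
qed

lemma sqrt_nu_mult_green_le: "sqrt (nu i) * green i j \<le> sqrt (nu j) * sqrt (green i i * green j j)"
proof -
  have "(nu i * green i j) * green i j \<le> (nu j * green i i) * green j j"
    by (intro mult_mono nu_mult_green_le green_le_diag green_nonneg mult_nonneg_nonneg)
      (simp add: nu_pos less_imp_le)
  then have "sqrt (nu i * (green i j)\<^sup>2) \<le> sqrt (nu j * (green i i * green j j))"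
    by (simp add: power2_eq_square mult.assoc)
  then show ?thesis
    by (simp add: real_sqrt_mult green_nonneg)
qed

end

section \<open>The twisted network at the bottleneck\<close>

lemma finite_pos_lower_bound:
  fixes g :: "'a \<Rightarrow> real"
  assumes "finite J" "\<And>j. j \<in> J \<Longrightarrow> 0 < g j"
  shows "\<exists>\<eta>>0. \<forall>j\<in>J. \<eta> \<le> g j"
  using assms by (intro exI[of _ "Min (insert 1 (g ` J))"]) simp

lemma perturbed_product_less:
  fixes m n M N X Y R :: real
  assumes "0 < n" "n < m" "0 < N" "0 \<le> R" and R: "(m - n) * R \<le> M - N"
    and X: "n * X \<le> N * R" and Y: "N * Y \<le> n * R" and XY: "X * Y < R\<^sup>2"
  shows "(N\<^sup>2 + n * (m - n) * X) * (1 + (m - n) / n * Y) < M\<^sup>2"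
proof -
  define a where "a = m - n"
  have "0 < a"
    using assms by (simp add: a_def)
  have "N\<^sup>2 * Y / n \<le> N * R"
    using mult_left_mono[OF Y, of N] assms(1,3) by (simp add: pos_divide_le_eq power2_eq_square mult_ac)
  then have linear: "a * (n * X + N\<^sup>2 * Y / n) \<le> a * (N * R + N * R)"
    using \<open>0 < a\<close> X by (intro mult_left_mono) auto
  have quadratic: "a\<^sup>2 * (X * Y) < a\<^sup>2 * R\<^sup>2"
    using \<open>0 < a\<close> XY by (intro mult_strict_left_mono) auto
  have "(N\<^sup>2 + n * a * X) * (1 + a / n * Y) = N\<^sup>2 + a * (n * X + N\<^sup>2 * Y / n) + a\<^sup>2 * (X * Y)"
    using assms(1) by (simp add: field_simps power2_eq_square)
  also have "\<dots> < N\<^sup>2 + a * (N * R + N * R) + a\<^sup>2 * R\<^sup>2"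
    using linear quadratic by linarith
  also have "\<dots> = (N + a * R)\<^sup>2"
    by (simp add: power2_eq_square algebra_simps)
  also have "\<dots> \<le> M\<^sup>2"
    using R assms(3,4) \<open>0 < a\<close> by (intro power_mono) (auto simp: a_def)
  finally show ?thesis
    unfolding a_def .
qed

locale jackson_bottleneck = jackson_network lam mu P nu
  for lam mu :: "'d::finite \<Rightarrow> real" and P :: "real^'d^'d" and nu :: "'d \<Rightarrow> real" +
  fixes i :: 'd
  assumes bottleneck:
    "(sqrt (mu i) - sqrt (nu i))\<^sup>2 / green i i \<le> (sqrt (mu j) - sqrt (nu j))\<^sup>2 / green j j"
begin

definition decay :: real where
  "decay = (sqrt (mu i) - sqrt (nu i))\<^sup>2 / green i i"

definition growth :: real where
  "growth = sqrt (mu i) / sqrt (nu i)"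

definition beta :: "'d \<Rightarrow> real" where
  "beta k = 1 + (growth - 1) * hit i k"

definition ratio :: "'d option \<Rightarrow> 'd option \<Rightarrow> real" where
  "ratio k l = case_option 1 beta l / case_option 1 beta k"

definition twisted :: "'d option \<Rightarrow> 'd option \<Rightarrow> real" where
  "twisted k l = rate k l * ratio k l"

definition weight :: "('d \<Rightarrow> nat) \<Rightarrow> real" where
  "weight x = (\<Prod>a\<in>UNIV. beta a ^ x a)"

lemma sqrt_nu_pos: "0 < sqrt (nu j)"
  by (simp add: nu_pos)

lemma sqrt_nu_less: "sqrt (nu j) < sqrt (mu j)"
  by (simp add: stable)

lemma growth_gt_1: "1 < growth"
  using sqrt_nu_pos[of i] sqrt_nu_less[of i] by (simp add: growth_def)

lemma mu_div_growth: "mu i / growth = sqrt (mu i) * sqrt (nu i)"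
proof -
  have "mu i = sqrt (mu i) * sqrt (mu i)"
    using mu_pos[of i] by simp
  then show ?thesis
    using growth_gt_1 sqrt_nu_pos[of i] by (simp add: growth_def field_simps)
qed

lemma mu_div_growth_eq: "mu i / growth = growth * nu i"
proof -
  have "nu i = sqrt (nu i) * sqrt (nu i)"
    using nu_pos[of i] by simp
  then show ?thesis
    unfolding mu_div_growth using sqrt_nu_pos[of i] by (simp add: growth_def field_simps)
qed

lemma decay_eq: "(growth - 1) * (mu i / growth - nu i) / green i i = decay"
proof -
  have "(growth - 1) * (m * n - n * n) = (growth * n - n) * (m - n)" for m n
    by (simp add: algebra_simps)
  from this[of "sqrt (mu i)" "sqrt (nu i)"]
  have "(growth - 1) * (mu i / growth - nu i)
      = (growth * sqrt (nu i) - sqrt (nu i)) * (sqrt (mu i) - sqrt (nu i))"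
    using nu_pos[of i] by (simp add: mu_div_growth)
  also have "growth * sqrt (nu i) = sqrt (mu i)"
    using sqrt_nu_pos[of i] by (simp add: growth_def)
  finally show ?thesis
    by (simp add: decay_def power2_eq_square)
qed

lemma beta_self [simp]: "beta i = growth"
  by (simp add: beta_def)

lemma beta_pos: "0 < beta k"
  using growth_gt_1 hit_nonneg[of i k] by (simp add: beta_def add_pos_nonneg)

lemma beta_nonzero [simp]: "beta k \<noteq> 0"
  using beta_pos[of k] by simp

lemma beta_harmonic:
  "p0 P k + (\<Sum>l\<in>UNIV. P$k$l * beta l) = beta k - of_bool (k = i) * (growth - 1) / green i i"
proof -
  have "(\<Sum>l\<in>UNIV. P$k$l * beta l) = (\<Sum>l\<in>UNIV. P$k$l) + (growth - 1) * (\<Sum>l\<in>UNIV. P$k$l * hit i l)"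
    by (simp add: beta_def algebra_simps sum.distrib sum_subtractf sum_distrib_left)
  then show ?thesis
    unfolding hit_harmonic by (simp add: beta_def p0_def algebra_simps)
qed

lemma twisted_nonneg: "0 \<le> twisted k l"
proof -
  have "0 \<le> case_option 1 beta k" for k
    using beta_pos by (cases k) (simp_all add: less_imp_le)
  then show ?thesis
    by (simp add: twisted_def ratio_def rate_nonneg)
qed

lemma weight_pos: "0 < weight x"
  unfolding weight_def by (intro prod_pos) (simp add: beta_pos)

lemma sum_lam_hit: "(\<Sum>a\<in>UNIV. lam a * hit i a) = nu i / green i i"
  by (simp add: hit_def nu_eq_sum_green sum_divide_distrib)

lemma jump_sum_ratio_minus_1:
  assumes "0 < x i"
  shows "jump_sum rate x (\<lambda>k l. ratio k l - 1) = - decay"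
proof -
  have arrivals: "(\<Sum>l\<in>UNIV. rate None l * (ratio None l - 1))
      = (growth - 1) * (\<Sum>a\<in>UNIV. lam a * hit i a)"
    unfolding sum_rate_arrivals by (simp add: ratio_def beta_def sum_distrib_left mult.left_commute)
  have services: "(\<Sum>l\<in>UNIV. rate (Some a) l * (ratio (Some a) l - 1))
      = of_bool (a = i) * (- (mu i / growth * (growth - 1) / green i i))" for a
  proof -
    have "(\<Sum>l\<in>UNIV. rate (Some a) l * (ratio (Some a) l - 1))
        = mu a * ((p0 P a + (\<Sum>c\<in>UNIV. P$a$c * beta c)) / beta a - (p0 P a + (\<Sum>c\<in>UNIV. P$a$c)))"
      unfolding sum_rate_services
      by (rule arg_cong[where f = "(*) (mu a)"])
        (simp add: ratio_def right_diff_distrib sum_subtractf sum_divide_distrib add_divide_distrib)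
    then show ?thesis
      unfolding beta_harmonic p0_sum using growth_gt_1
      by (cases "a = i") (simp_all add: diff_divide_distrib right_diff_distrib)
  qed
  have "jump_sum rate x (\<lambda>k l. ratio k l - 1)
      = (growth - 1) * (nu i / green i i) - mu i / growth * (growth - 1) / green i i"
    unfolding jump_sum_rows arrivals services sum_lam_hit sum_of_bool_eq_mult[OF finite]
    using assms by simp
  also have "\<dots> = - decay"
    unfolding decay_eq[symmetric] using growth_gt_1 green_diag_pos[of i] by (simp add: field_simps)
  finally show ?thesis .
qed

lemma gen_twist:
  assumes "0 < x i"
  shows "gen rate (\<lambda>z. weight z * \<psi> z) x = weight x * (gen twisted \<psi> x - decay * \<psi> x)"
proof -
  have "weight (move k l x) = weight x * ratio k l" if "enabled k x" for k l
    unfolding weight_def ratio_def using beta_pos that by (rule prod_power_move)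
  then show ?thesis
    using jump_sum_ratio_minus_1[of x] assms
    by (simp add: gen_conjugate[where r = ratio] twisted_def[abs_def])
qed

lemma gen_twisted_lin:
  "gen twisted (lin (\<lambda>k. V k / beta k)) x = (\<Sum>a\<in>UNIV. lam a * V a)
     + (\<Sum>a | 0 < x a. mu a / beta a
          * ((\<Sum>c\<in>UNIV. P$a$c * V c) - V a
            + of_bool (a = i) * ((growth - 1) / (growth * green i i) * V i)))"
proof -
  let ?incr = "increment (\<lambda>k. V k / beta k)"
  have "(\<Sum>l\<in>UNIV. twisted None l * ?incr None l) = (\<Sum>a\<in>UNIV. lam a * V a)"
    unfolding twisted_def mult.assoc sum_rate_arrivals by (simp add: ratio_def increment_def)
  moreover have "(\<Sum>l\<in>UNIV. twisted (Some a) l * ?incr (Some a) l)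
      = mu a / beta a * ((\<Sum>c\<in>UNIV. P$a$c * V c) - V a
          + of_bool (a = i) * ((growth - 1) / (growth * green i i) * V i))" for a
  proof -
    have "(\<Sum>l\<in>UNIV. twisted (Some a) l * ?incr (Some a) l)
        = mu a * (p0 P a * (- (V a / beta a)) / beta a
            + (\<Sum>c\<in>UNIV. P$a$c * V c / beta a - P$a$c * beta c * (V a / beta a) / beta a))"
      unfolding twisted_def mult.assoc sum_rate_services
      by (simp add: ratio_def increment_def right_diff_distrib)
    also have "\<dots> = mu a / beta a
        * ((\<Sum>c\<in>UNIV. P$a$c * V c) - V a / beta a * (p0 P a + (\<Sum>c\<in>UNIV. P$a$c * beta c)))"
      by (simp add: sum_subtractf algebra_simps flip: sum_divide_distrib sum_distrib_left sum_distrib_right)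
    finally show ?thesis
      unfolding beta_harmonic using growth_gt_1
      by (cases "a = i") (simp_all add: algebra_simps diff_divide_distrib)
  qed
  ultimately show ?thesis
    unfolding gen_lin jump_sum_rows by simp
qed

definition martingale_coeff :: "'d \<Rightarrow> real" where
  "martingale_coeff k = growth * hit i k / beta k"

lemma martingale_coeff_nonneg: "0 \<le> martingale_coeff k"
  using growth_gt_1 hit_nonneg[of i k] beta_pos[of k] by (simp add: martingale_coeff_def)

lemma martingale_coeff_le_1: "martingale_coeff k \<le> 1"
  using hit_le_1[of i k] beta_pos[of k] by (simp add: martingale_coeff_def beta_def algebra_simps)

lemma martingale_coeff_self: "martingale_coeff i = 1"
  using growth_gt_1 by (simp add: martingale_coeff_def)

lemma gen_twisted_martingale:
  assumes "0 < x i"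
  shows "gen twisted (lin martingale_coeff) x = 0"
proof -
  have row: "(\<Sum>c\<in>UNIV. P$a$c * (growth * hit i c)) - growth * hit i a
        + of_bool (a = i) * ((growth - 1) / (growth * green i i) * (growth * hit i i))
      = of_bool (a = i) * (- (1 / green i i))" for a
  proof -
    have sum_hit: "(\<Sum>c\<in>UNIV. P$a$c * (growth * hit i c))
        = growth * (hit i a - of_bool (a = i) / green i i)"
      unfolding hit_harmonic[symmetric] by (simp add: sum_distrib_left mult.left_commute)
    show ?thesis
      unfolding sum_hit using growth_gt_1 green_diag_pos[of i]
      by (cases "a = i") (simp_all add: field_simps)
  qed
  have "gen twisted (lin martingale_coeff) x = (\<Sum>a\<in>UNIV. lam a * (growth * hit i a))
      + (\<Sum>a | 0 < x a. of_bool (a = i) * (mu a / beta a * - (1 / green i i)))"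
    unfolding martingale_coeff_def[abs_def] gen_twisted_lin row by (simp add: mult_ac)
  also have "(\<Sum>a\<in>UNIV. lam a * (growth * hit i a)) = growth * (nu i / green i i)"
    unfolding sum_lam_hit[symmetric] by (simp add: sum_distrib_left mult.left_commute)
  also have "(\<Sum>a | 0 < x a. of_bool (a = i) * (mu a / beta a * - (1 / green i i)))
      = - (mu i / growth / green i i)"
    unfolding sum_of_bool_eq_mult[OF finite] using assms by simp
  finally show ?thesis
    unfolding mu_div_growth_eq by simp
qed

lemma martingale_variance_pos: "0 < (\<Sum>l\<in>UNIV. twisted None l * (increment martingale_coeff None l)\<^sup>2)"
proof -
  have "\<exists>a. lam a * hit i a \<noteq> 0"
  proof (rule ccontr)
    assume "\<nexists>a. lam a * hit i a \<noteq> 0"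
    then have "(\<Sum>a\<in>UNIV. lam a * hit i a) = 0"
      by (intro sum.neutral) blast
    then show False
      using sum_lam_hit nu_pos[of i] green_diag_pos[of i] by simp
  qed
  then obtain a where a: "0 < lam a" "0 < hit i a"
    using lam_nonneg hit_nonneg by (auto simp: order_less_le)
  have "0 < twisted None (Some a) * (increment martingale_coeff None (Some a))\<^sup>2"
    using a beta_pos[of a] growth_gt_1
    by (simp add: twisted_def ratio_def increment_def martingale_coeff_def)
  also have "\<dots> \<le> (\<Sum>l\<in>UNIV. twisted None l * (increment martingale_coeff None l)\<^sup>2)"
    by (intro member_le_sum) (auto simp: twisted_nonneg)
  finally show ?thesis .
qed

text \<open>After twisting, queue \<open>i\<close> is always busy and queue \<open>j\<close> has throughput \<open>throughput j * beta j\<close>.\<close>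
definition throughput :: "'d \<Rightarrow> real" where
  "throughput j = killed_flow i lam j + mu i / growth * (green i j / green i i)"

lemma throughput_eq:
  "throughput j = nu j + sqrt (nu i) * (sqrt (mu i) - sqrt (nu i)) * (green i j / green i i)"
proof -
  have excess: "sqrt (nu i) * (sqrt (mu i) - sqrt (nu i)) = mu i / growth - nu i"
    unfolding mu_div_growth using nu_pos[of i] by (simp add: right_diff_distrib mult.commute)
  show ?thesis
    unfolding excess throughput_def killed_flow_of_inflow[OF traffic]
    by (simp add: left_diff_distrib diff_divide_distrib)
qed

lemma bottleneck_sqrt:
  "(sqrt (mu i) - sqrt (nu i)) * (sqrt (green i i * green j j) / green i i) \<le> sqrt (mu j) - sqrt (nu j)"
proof (rule power2_le_imp_le)
  show "((sqrt (mu i) - sqrt (nu i)) * (sqrt (green i i * green j j) / green i i))\<^sup>2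
      \<le> (sqrt (mu j) - sqrt (nu j))\<^sup>2"
    using bottleneck[of j] green_diag_pos[of i] green_diag_pos[of j]
    by (simp add: power_mult_distrib power_divide pos_le_divide_eq) (simp add: power2_eq_square)
qed (use sqrt_nu_less[of j] in simp)

lemma throughput_stable:
  assumes "j \<noteq> i"
  shows "throughput j * beta j < mu j"
proof -
  let ?m = "sqrt (mu i)" and ?n = "sqrt (nu i)" and ?M = "sqrt (mu j)" and ?N = "sqrt (nu j)"
  let ?X = "green i j / green i i" and ?Y = "green j i / green i i"
    and ?R = "sqrt (green i i * green j j) / green i i"
  have diag_pos: "0 < green i i" "0 < green j j"
    by (rule green_diag_pos)+
  have "(?N\<^sup>2 + ?n * (?m - ?n) * ?X) * (1 + (?m - ?n) / ?n * ?Y) < ?M\<^sup>2"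
  proof (rule perturbed_product_less)
    show "?n * ?X \<le> ?N * ?R"
      using divide_right_mono[OF sqrt_nu_mult_green_le[of i j], of "green i i"] diag_pos by simp
    show "?N * ?Y \<le> ?n * ?R"
      using divide_right_mono[OF sqrt_nu_mult_green_le[of j i], of "green i i"] diag_pos
      by (simp add: mult.commute)
    show "?X * ?Y < ?R\<^sup>2"
      using divide_strict_right_mono[OF green_mult_green_less[of i j], of "green i i * green i i"]
        assms diag_pos
      by (simp add: power_divide power2_eq_square)
  qed (use bottleneck_sqrt diag_pos sqrt_nu_pos sqrt_nu_less in auto)
  moreover have "beta j = 1 + (?m - ?n) / ?n * ?Y"
    using sqrt_nu_pos[of i] by (simp add: beta_def hit_def growth_def field_simps)
  ultimately show ?thesis
    using nu_pos[of j] mu_pos[of j] by (simp add: throughput_eq)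
qed

definition visits :: "'d \<Rightarrow> real" where
  "visits j = killed_flow i (\<lambda>_. 1) j"

definition workload_coeff :: "'d \<Rightarrow> 'd \<Rightarrow> real" where
  "workload_coeff j k = green_killed i k j / beta k / visits j"

lemma visits_ge_1: "j \<noteq> i \<Longrightarrow> 1 \<le> visits j"
  unfolding visits_def by (rule killed_flow_ge) simp_all

lemma lin_workload_coeff:
  "lin (workload_coeff j) x = killed_flow i (\<lambda>m. real (x m) / beta m) j / visits j"
  by (simp add: lin_def workload_coeff_def killed_flow_def sum_divide_distrib mult.commute)

lemma gen_twisted_workload:
  assumes "0 < x i" "j \<noteq> i"
  shows "gen twisted (lin (workload_coeff j)) x
    = (throughput j - of_bool (0 < x j) * (mu j / beta j)) / visits j"
proof -
  have row: "(\<Sum>c\<in>UNIV. P$a$c * green_killed i c j) - green_killed i a j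
        + of_bool (a = i) * ((growth - 1) / (growth * green i i) * green_killed i i j)
      = of_bool (a = i) * (green i j / green i i) - of_bool (a = j)" for a
    unfolding green_killed_right by simp
  have "gen twisted (lin (\<lambda>k. green_killed i k j / beta k)) x = (\<Sum>a\<in>UNIV. lam a * green_killed i a j)
      + ((\<Sum>a | 0 < x a. of_bool (a = i) * (mu a / beta a * (green i j / green i i)))
        - (\<Sum>a | 0 < x a. of_bool (a = j) * (mu a / beta a)))"
    unfolding gen_twisted_lin row sum_subtractf[symmetric] by (simp add: algebra_simps)
  also have "\<dots> = throughput j - of_bool (0 < x j) * (mu j / beta j)"
    using assms unfolding sum_of_bool_eq_mult[OF finite] by (simp add: throughput_def killed_flow_def)
  finally have "gen twisted (lin (\<lambda>k. green_killed i k j / beta k)) x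
      = throughput j - of_bool (0 < x j) * (mu j / beta j)" .
  moreover have "lin (workload_coeff j) = (\<lambda>x. 1 / visits j * lin (\<lambda>k. green_killed i k j / beta k) x)"
    by (simp add: fun_eq_iff lin_def workload_coeff_def sum_divide_distrib)
  ultimately show ?thesis
    by (simp only: gen_cmult) simp
qed

lemma idle_workload_le:
  assumes "j \<noteq> i" "x j = 0" "\<And>k. k \<noteq> i \<Longrightarrow> lin (workload_coeff k) x \<le> \<tau>"
  shows "lin (workload_coeff j) x \<le> (1 - 1 / visits j) * \<tau>"
proof -
  have "killed_flow i (\<lambda>m. real (x m) / beta m) j \<le> \<tau> * (visits j - 1)"
    unfolding visits_def
  proof (rule killed_flow_le_of_no_source)
    show "killed_flow i (\<lambda>m. real (x m) / beta m) k \<le> \<tau> * killed_flow i (\<lambda>_. 1) k" if "k \<noteq> i" for k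
      using assms(3)[OF that] visits_ge_1[OF that] unfolding lin_workload_coeff
      by (simp add: pos_divide_le_eq flip: visits_def)
  qed (use assms in simp_all)
  then show ?thesis
    using visits_ge_1[OF assms(1)] unfolding lin_workload_coeff by (simp add: field_simps)
qed

lemma uniform_workload_constants:
  obtains \<eta> \<alpha> C where "0 < \<eta>" "0 < \<alpha>" "0 \<le> C"
    "\<And>j. j \<noteq> i \<Longrightarrow> 2 * \<eta> \<le> (mu j / beta j - throughput j) / visits j"
    "\<And>j. j \<noteq> i \<Longrightarrow> \<alpha> \<le> 1 / visits j" "\<And>j. throughput j / visits j \<le> C"
proof -
  let ?C = "Max (insert 0 (range (\<lambda>j. throughput j / visits j)))"
  have "0 < (mu j / beta j - throughput j) / visits j / 2" "0 < 1 / visits j" if "j \<noteq> i" for j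
    using throughput_stable[of j] visits_ge_1[of j] beta_pos[of j] that
    by (simp_all add: pos_less_divide_eq)
  then have "\<exists>\<eta>>0. \<forall>j\<in>UNIV - {i}. \<eta> \<le> (mu j / beta j - throughput j) / visits j / 2"
    and "\<exists>\<alpha>>0. \<forall>j\<in>UNIV - {i}. \<alpha> \<le> 1 / visits j"
    by (intro finite_pos_lower_bound; simp)+
  then obtain \<eta> \<alpha> where "0 < \<eta>" "0 < \<alpha>"
    and gap: "\<forall>j\<in>UNIV - {i}. \<eta> \<le> (mu j / beta j - throughput j) / visits j / 2"
    and inverse_visits: "\<forall>j\<in>UNIV - {i}. \<alpha> \<le> 1 / visits j"
    by blast
  have "2 * \<eta> \<le> (mu j / beta j - throughput j) / visits j" if "j \<noteq> i" for j
    using bspec[OF gap, of j] that by (simp only: le_divide_eq_numeral1 mult.commute) simp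
  moreover have "\<alpha> \<le> 1 / visits j" if "j \<noteq> i" for j
    using inverse_visits that by blast
  moreover have "throughput j / visits j \<le> ?C" for j
    by (intro Max_ge) auto
  ultimately show thesis
    using that[of \<eta> \<alpha> ?C] \<open>0 < \<eta>\<close> \<open>0 < \<alpha>\<close> by simp
qed

lemma workload_lyapunov:
  obtains a D \<kappa> where "0 < a" "0 < D" "0 < \<kappa>"
    "\<And>x. 0 < x i \<Longrightarrow> gen twisted (\<lambda>x. \<Sum>j\<in>UNIV - {i}. exp (a * lin (workload_coeff j) x)) x
       \<le> D - \<kappa> * (\<Sum>j\<in>UNIV - {i}. exp (a * lin (workload_coeff j) x))"
proof -
  let ?w = workload_coeff
  obtain \<eta> \<alpha> C where constants: "0 < \<eta>" "0 < \<alpha>" "0 \<le> C"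
    and gap: "\<And>j. j \<noteq> i \<Longrightarrow> 2 * \<eta> \<le> (mu j / beta j - throughput j) / visits j"
    and inverse_visits: "\<And>j. j \<noteq> i \<Longrightarrow> \<alpha> \<le> 1 / visits j"
    and C: "\<And>j. throughput j / visits j \<le> C"
    by (rule uniform_workload_constants) (rule that)
  have dichotomy: "gen twisted (lin (?w j)) x \<le> - (2 * \<eta>) \<or> gen twisted (lin (?w j)) x \<le> C
      \<and> (\<forall>\<tau>\<ge>0. (\<forall>k\<in>UNIV - {i}. lin (?w k) x \<le> \<tau>) \<longrightarrow> lin (?w j) x \<le> (1 - \<alpha>) * \<tau>)"
    if "0 < x i" "j \<noteq> i" for x j
  proof (cases "0 < x j")
    case True
    then show ?thesis
      using that gap[of j] by (simp add: gen_twisted_workload diff_divide_distrib)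
  next
    case False
    have "lin (?w j) x \<le> (1 - \<alpha>) * \<tau>" if "0 \<le> \<tau>" "\<forall>k\<in>UNIV - {i}. lin (?w k) x \<le> \<tau>" for \<tau>
    proof -
      have "lin (?w j) x \<le> (1 - 1 / visits j) * \<tau>"
        by (rule idle_workload_le) (use False \<open>j \<noteq> i\<close> that in auto)
      also have "\<dots> \<le> (1 - \<alpha>) * \<tau>"
        using inverse_visits[OF \<open>j \<noteq> i\<close>] that(1) by (intro mult_right_mono) auto
      finally show ?thesis .
    qed
    then show ?thesis
      using False that C[of j] by (simp add: gen_twisted_workload)
  qed
  show thesis
    by (rule exp_lyapunov[where q = twisted and w = ?w and J = "UNIV - {i}" and \<eta> = \<eta>
            and \<rho> = "1 - \<alpha>" and C = C and S = "{x. 0 < x i}"])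
      (use twisted_nonneg constants dichotomy that in auto)
qed

lemma queue_le_of_exp_workload_le:
  assumes "0 < a" "k \<noteq> i" "exp (a * lin (workload_coeff k) x) \<le> B"
  shows "real (x k) \<le> beta k * (visits k * (B / a))"
proof -
  have "real (x k) / beta k \<le> killed_flow i (\<lambda>m. real (x m) / beta m) k"
    using assms(2) by (intro killed_flow_ge) (simp_all add: beta_pos less_imp_le)
  also have "\<dots> = visits k * lin (workload_coeff k) x"
    using visits_ge_1[OF assms(2)] by (simp add: lin_workload_coeff)
  also have "\<dots> \<le> visits k * (B / a)"
  proof (rule mult_left_mono)
    have "a * lin (workload_coeff k) x \<le> B"
      using exp_ge_add_one_self[of "a * lin (workload_coeff k) x"] assms(3) by linarith
    then show "lin (workload_coeff k) x \<le> B / a"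
      using assms(1) by (simp add: pos_le_divide_eq mult.commute)
  qed (use visits_ge_1[OF assms(2)] in simp)
  finally show ?thesis
    using beta_pos[of k] by (simp add: pos_divide_le_eq mult.commute)
qed

lemma twisted_test_function:
  assumes "0 < \<epsilon>"
  obtains \<psi> x0 where "finite {x. \<psi> x \<noteq> 0}" "\<And>x. 0 \<le> \<psi> x" "\<psi> x0 \<noteq> 0" "\<And>x. \<psi> x \<noteq> 0 \<Longrightarrow> N \<le> real (x i)"
    "\<And>x. 0 < x i \<Longrightarrow> \<psi> x \<noteq> 0 \<Longrightarrow> - \<epsilon> * \<psi> x \<le> gen twisted \<psi> x"
proof -
  obtain a D \<kappa> where "0 < a" "0 < D" "0 < \<kappa>"
    and lyapunov: "\<And>x. 0 < x i \<Longrightarrow> gen twisted (\<lambda>x. \<Sum>j\<in>UNIV - {i}. exp (a * lin (workload_coeff j) x)) x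
       \<le> D - \<kappa> * (\<Sum>j\<in>UNIV - {i}. exp (a * lin (workload_coeff j) x))"
    by (rule workload_lyapunov) (rule that)
  define W where "W x = (\<Sum>j\<in>UNIV - {i}. exp (a * lin (workload_coeff j) x))" for x
  interpret confined_martingale twisted martingale_coeff i W "real (card (UNIV - {i}))" D \<kappa>
    "\<Sum>l\<in>UNIV. twisted None l * (increment martingale_coeff None l)\<^sup>2"
  proof
    show "0 \<le> W x" for x
      by (simp add: W_def sum_nonneg)
    have "lin (workload_coeff j) ((\<lambda>_. 0)(i := n)) = 0" for j n
      unfolding lin_def by (intro sum.neutral) (simp add: workload_coeff_def)
    then show "W ((\<lambda>_. 0)(i := n)) \<le> real (card (UNIV - {i}))" for n
      by (simp add: W_def)
    show "\<exists>Y. \<forall>x k. W x \<le> B \<longrightarrow> k \<noteq> i \<longrightarrow> real (x k) \<le> Y" for B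
    proof (intro exI allI impI)
      fix x k
      assume "W x \<le> B" "k \<noteq> i"
      have "exp (a * lin (workload_coeff k) x) \<le> W x"
        unfolding W_def using \<open>k \<noteq> i\<close> by (intro member_le_sum) auto
      then have "real (x k) \<le> beta k * (visits k * (B / a))"
        using \<open>W x \<le> B\<close> by (intro queue_le_of_exp_workload_le[OF \<open>0 < a\<close> \<open>k \<noteq> i\<close>]) simp
      also have "\<dots> \<le> Max (range (\<lambda>k. beta k * (visits k * (B / a))))"
        by (intro Max_ge) auto
      finally show "real (x k) \<le> Max (range (\<lambda>k. beta k * (visits k * (B / a))))" .
    qed
    show "gen twisted W x \<le> D - \<kappa> * W x" if "0 < x i" for x
      using lyapunov[of x] that unfolding W_def by blast
  qed (use twisted_nonneg martingale_coeff_nonneg martingale_coeff_le_1 martingale_coeff_self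
      gen_twisted_martingale martingale_variance_pos qvar_ge_arrivals[OF twisted_nonneg]
      \<open>0 < D\<close> \<open>0 < \<kappa>\<close> in auto)
  show thesis
    by (rule ex_test_function[OF assms]) (rule that)
qed

lemma sub_eigenfunction_of_twisted:
  assumes "finite {x. \<psi> x \<noteq> 0}" "\<And>x. 0 \<le> \<psi> x" "\<And>x. \<psi> x \<noteq> 0 \<Longrightarrow> 0 < x i"
    and "\<And>x. 0 < x i \<Longrightarrow> \<psi> x \<noteq> 0 \<Longrightarrow> - \<epsilon> * \<psi> x \<le> gen twisted \<psi> x"
  shows "sub_eigenfunction (decay + \<epsilon>) (\<lambda>x. weight x * \<psi> x)"
proof -
  have nonneg: "0 \<le> weight x * \<psi> x" for x
    using weight_pos[of x] assms(2) by simp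
  have "- (decay + \<epsilon>) * (weight x * \<psi> x) \<le> gen rate (\<lambda>x. weight x * \<psi> x) x" for x
  proof (cases "\<psi> x = 0")
    case True
    have "gen rate (\<lambda>_. 0) x \<le> gen rate (\<lambda>x. weight x * \<psi> x) x"
      by (rule gen_mono_at) (simp_all add: rate_nonneg nonneg True)
    then show ?thesis
      by (simp add: True gen_def jump_sum_def)
  next
    case False
    then have "weight x * (- \<epsilon> * \<psi> x) \<le> weight x * gen twisted \<psi> x"
      using assms(3,4)[of x] weight_pos[of x] by (intro mult_left_mono) auto
    then show ?thesis
      using gen_twist[of x \<psi>] assms(3)[OF False] by (simp add: algebra_simps)
  qed
  moreover have "weight x * \<psi> x \<noteq> 0 \<longleftrightarrow> \<psi> x \<noteq> 0" for x
    using weight_pos[of x] by simp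
  ultimately show ?thesis
    unfolding sub_eigenfunction_def using assms(1) nonneg by simp
qed

lemma ex_sub_eigenfunction:
  assumes "finite E" "0 < \<epsilon>"
  shows "\<exists>f. sub_eigenfunction (decay + \<epsilon>) f \<and> (\<forall>z\<in>E. f z = 0) \<and> (\<exists>x. f x \<noteq> 0)"
proof -
  obtain \<psi> x0 where \<psi>: "finite {x. \<psi> x \<noteq> 0}" "\<And>x. 0 \<le> \<psi> x" "\<psi> x0 \<noteq> 0"
    and far: "\<And>x. \<psi> x \<noteq> 0 \<Longrightarrow> real (Suc (\<Sum>e\<in>E. e i)) \<le> real (x i)"
    and sub: "\<And>x. 0 < x i \<Longrightarrow> \<psi> x \<noteq> 0 \<Longrightarrow> - \<epsilon> * \<psi> x \<le> gen twisted \<psi> x"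
    by (rule twisted_test_function[OF assms(2)]) (rule that)
  have busy: "0 < x i" if "\<psi> x \<noteq> 0" for x
    using far[OF that] unfolding of_nat_le_iff by simp
  have "sub_eigenfunction (decay + \<epsilon>) (\<lambda>x. weight x * \<psi> x)"
    using \<psi>(1,2) busy sub by (rule sub_eigenfunction_of_twisted)
  moreover have "\<psi> e = 0" if "e \<in> E" for e
  proof -
    have "e i \<le> (\<Sum>e\<in>E. e i)"
      using that \<open>finite E\<close> by (intro member_le_sum) auto
    then show ?thesis
      using far[of e] unfolding of_nat_le_iff by linarith
  qed
  moreover have "weight x0 * \<psi> x0 \<noteq> 0"
    using \<psi>(3) weight_pos[of x0] by simp
  ultimately show ?thesis
    by (intro exI[of _ "\<lambda>x. weight x * \<psi> x"]) auto
qed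

lemma exp_decay_le_ess_spec_radius: "exp (- decay) \<le> ess_spec_radius lam mu P"
proof (rule tendsto_upperbound)
  show "((\<lambda>\<epsilon>. exp (- (decay + \<epsilon>))) \<longlongrightarrow> exp (- decay)) (at_right 0)"
    by (auto intro!: tendsto_eq_intros)
  show "\<forall>\<^sub>F \<epsilon> in at_right 0. exp (- (decay + \<epsilon>)) \<le> ess_spec_radius lam mu P"
    using eventually_at_right_less[of 0]
    by eventually_elim (intro exp_le_ess_spec_radius ex_sub_eigenfunction)
qed simp

end

theorem theorem2p3:
  fixes lam mu nu :: "'d::finite \<Rightarrow> real" and P :: "real^'d^'d"
  assumes lam_nonneg: "\<forall>i. 0 \<le> lam i"
    and mu_pos: "\<forall>i. 0 < mu i"
    and P_nonneg: "\<forall>i j. 0 \<le> P$i$j"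
    and P_diag: "\<forall>i. P$i$i = 0"
    and P_substoch: "\<forall>i. (\<Sum>j\<in>UNIV. P$i$j) \<le> 1"
    and hypA: "jackson_irreducible lam mu P"
    and traffic: "\<forall>j. nu j = lam j + (\<Sum>i\<in>UNIV. nu i * P$i$j)"
    and hypB: "\<forall>i. nu i < mu i"
  shows "exp (- Min (range (\<lambda>i. (sqrt (mu i) - sqrt (nu i))\<^sup>2 / (matrix_inv (mat 1 - P))$i$i)))
           \<le> ess_spec_radius lam mu P"
proof -
  interpret jackson_network lam mu P nu
    by unfold_locales (use assms in blast)+
  let ?g = "\<lambda>i. (sqrt (mu i) - sqrt (nu i))\<^sup>2 / green i i"
  have "Min (range ?g) \<in> range ?g"
    by (intro Min_in) auto
  then obtain i where i: "Min (range ?g) = ?g i"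
    by (rule rangeE)
  have "?g i \<le> ?g j" for j
    unfolding i[symmetric] by (intro Min_le) auto
  then interpret jackson_bottleneck lam mu P nu i
    by unfold_locales
  show ?thesis
    using exp_decay_le_ess_spec_radius unfolding decay_def i[symmetric] unfolding green_def .
qed

end
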